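(* Let $a\in\mathbb{R}$, $b\in(a,\infty)$, $h\in\mathbb{N}$, $v_1,\dots,v_h,w_1,\dots,w_h\in(0,\infty)$, and let $f,p\in C(\mathbb{R},\mathbb{R})$ satisfy for all $x\in\mathbb{R}$ that $p(x)\ge0$ and $p^{-1}((0,\infty))=(a,b)$; with $\mathcal{N}^\theta$, $\mathcal{L}$, $I_i^\theta$, $\psi_i$, $\operatorname{Lip}$ as in the context. Assume that $f$ is non-decreasing and satisfies $\operatorname{Lip}(f)<\min_{i\in\{1,\dots,h\}}v_iw_i$, let $\Theta\in C([0,\infty),\mathbb{R}^{h+1})$ satisfy for all $t\in[0,\infty)$ that $\Theta_t=\Theta_0-\int_0^t(\nabla\mathcal{L})(\Theta_s)\,\mathrm{d}s$, let $\vartheta\in\mathbb{R}^{h+1}$ satisfy $\limsup_{t\to\infty}\|\Theta_t-\vartheta\|=0$, let $V=\sup_{x\in(a,b)}\sum_{i\in\{1,\dots,h\},\,x\in I_i^\vartheta}v_i$, assume $$V<\Big[\int_a^bp(x)\,\mathrm{d}x\Big]^{-1}\min\Big\{\int_a^b(f(b)-f(x))p(x)\,\mathrm{d}x,\int_a^b(f(x)-f(a))p(x)\,\mathrm{d}x\Big\},$$ and assume $\sum_{i=1}^hv_i\mathbb{1}_{(a-[w_i]^{-1},b)}(\psi_i(\Theta_0))>f(b)-f(a)+4V$. Then $$\mathcal{L}(\vartheta)\le\big(2V^2+(f(b)-f(a))V\big)\int_a^bp(x)\,\mathrm{d}x.$$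
   Context: Let $\mathfrak{c}(x)=\min\{\max\{x,0\},1\}$ (clipping function). For $F\in C(\mathbb{R},\mathbb{R})$ let $\operatorname{Lip}(F)=\sup_{x,y\in[a,b],x\neq y}\frac{|F(x)-F(y)|}{|x-y|}$. For $\theta=(\theta_1,\dots,\theta_{h+1})\in\mathbb{R}^{h+1}$ and $i\in\{1,\dots,h\}$ let $\psi_i(\theta)=-[w_i]^{-1}\theta_i$, let $I_i^\theta=(\psi_i(\theta),\psi_i(\theta)+[w_i]^{-1})\cap(a,b)$, let $\mathcal{N}^\theta(x)=\theta_{h+1}+\sum_{i=1}^hv_i\mathfrak{c}(w_ix+\theta_i)$ for $x\in\mathbb{R}$, and let $\mathcal{L}(\theta)=\int_a^b(\mathcal{N}^\theta(x)-f(x))^2p(x)\,\mathrm{d}x$. ($\mathcal{L}$ is continuously differentiable, so $\nabla\mathcal{L}$ is the usual gradient.) $\|\cdot\|$ is the Euclidean norm and $\mathbb{1}_A$ the indicator function. *)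

theory Defs
  imports "HOL-Analysis.Analysis"
begin

text \<open>Parameters are indexed by a finite type 'h with CARD('h) = h; the parameter
 vector theta in R^(h+1) is a vector indexed by 'h option: theta $ Some i is theta_i
 (i = 1..h) and theta $ None is theta_(h+1).\<close>

definition clip :: "real \<Rightarrow> real" where
  "clip x = min (max x 0) 1"

definition Lip :: "real \<Rightarrow> real \<Rightarrow> (real \<Rightarrow> real) \<Rightarrow> ereal" where
  "Lip a b F = Sup {ereal (\<bar>F x - F y\<bar> / \<bar>x - y\<bar>) | x y. x \<in> {a..b} \<and> y \<in> {a..b} \<and> x \<noteq> y}"

definition psi :: "('h \<Rightarrow> real) \<Rightarrow> 'h \<Rightarrow> real ^ ('h::finite option) \<Rightarrow> real" where
  "psi w i \<theta> = - (1 / w i) * \<theta> $ Some i"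

definition Iset :: "real \<Rightarrow> real \<Rightarrow> ('h \<Rightarrow> real) \<Rightarrow> 'h \<Rightarrow> real ^ ('h::finite option) \<Rightarrow> real set" where
  "Iset a b w i \<theta> = {psi w i \<theta> <..< psi w i \<theta> + 1 / w i} \<inter> {a<..<b}"

definition NN :: "('h \<Rightarrow> real) \<Rightarrow> ('h \<Rightarrow> real) \<Rightarrow> real ^ ('h::finite option) \<Rightarrow> real \<Rightarrow> real" where
  "NN v w \<theta> x = \<theta> $ None + (\<Sum>i\<in>UNIV. v i * clip (w i * x + \<theta> $ Some i))"

definition loss :: "real \<Rightarrow> real \<Rightarrow> (real \<Rightarrow> real) \<Rightarrow> (real \<Rightarrow> real) \<Rightarrow> ('h \<Rightarrow> real) \<Rightarrow> ('h \<Rightarrow> real)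
    \<Rightarrow> real ^ ('h::finite option) \<Rightarrow> real" where
  "loss a b f p v w \<theta> = integral {a..b} (\<lambda>x. (NN v w \<theta> x - f x)\<^sup>2 * p x)"

text \<open>Gradient: vector of partial derivatives (L is C^1, so this is the usual gradient).\<close>
definition grad :: "(real ^ 'n \<Rightarrow> real) \<Rightarrow> real ^ 'n \<Rightarrow> real ^ 'n" where
  "grad L \<theta> = (\<chi> j. frechet_derivative L (at \<theta>) (axis j 1))"

end

theory Submission
  imports Defs
begin

text \<open>Let g = N - f at the limit, which is a critical point. Then g p has integral zero over (a, b) and
  over every interval I_i. By the slope condition g is strictly increasing on each nonempty I_i,
  so it vanishes exactly once there, and overlapping intervals share their zero; this gives
  |g| \<le> V on the nonempty I_i. Away from them N is constant and g non-increasing, hence g \<le> V to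
  the right of some nonempty I_i and g \<ge> -V to the left of one.

  A neuron active at time 0 stays active in finite time and can become inactive in the limit only
  by drifting out through b, which forces g(b) \<ge> 0, or through a, which forces g(a) \<le> 0. If none
  did, N would rise on [a, b] by more than f(b) - f(a) + 2V, contradicting the bounds on g(a) and g(b).
  If g(b) \<ge> 0, then -V \<le> g \<le> M on [a, b] with M = max (f(b) - f(a)) V, and integrating
  (g + V) (M - g) p \<ge> 0 bounds the loss by M V times the mass of p; the case g(a) \<le> 0 is symmetric.
  If all I_i were empty, N would be constant and g(b) \<ge> 0 (or g(a) \<le> 0) would contradict the
  smallness of V.\<close>

subsection \<open>Integrals of the clipping function\<close>

text \<open>Below the radius \<open>e / (\<bar>C\<bar> + 1)\<close> a quadratic remainder is at most
  \<open>e\<close> times the norm. This allows differentiating the loss although the clip has kinks: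
  only the integrated remainder has to be quadratic.\<close>

lemma has_derivative_quadratic_remainder:
  fixes F :: "'a::real_normed_vector \<Rightarrow> real"
  assumes "bounded_linear D" and rem: "\<And>h. \<bar>F (x + h) - F x - D h\<bar> \<le> C * (norm h)\<^sup>2"
  shows "(F has_derivative D) (at x)"
  unfolding has_derivative_at_alt
proof (intro conjI allI impI)
  show "bounded_linear D" by fact
  fix e :: real assume "e > 0"
  have "norm (F y - F x - D (y - x)) \<le> e * norm (y - x)"
    if y: "norm (y - x) < e / (\<bar>C\<bar> + 1)" for y
  proof -
    have "norm (F y - F x - D (y - x)) \<le> C * (norm (y - x))\<^sup>2"
      using rem[of "y - x"] by simp
    also have "\<dots> \<le> (\<bar>C\<bar> + 1) * (norm (y - x))\<^sup>2"
      by (intro mult_right_mono) auto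
    also have "\<dots> = ((\<bar>C\<bar> + 1) * norm (y - x)) * norm (y - x)"
      by (simp add: power2_eq_square)
    also have "\<dots> \<le> e * norm (y - x)"
      using y by (intro mult_right_mono) (auto simp: field_simps)
    finally show ?thesis .
  qed
  then show "\<exists>d>0. \<forall>y. norm (y - x) < d \<longrightarrow> norm (F y - F x - D (y - x)) \<le> e * norm (y - x)"
    using \<open>e > 0\<close> by (intro exI[of _ "e / (\<bar>C\<bar> + 1)"]) (auto intro!: divide_pos_pos)
qed

lemma clip_nonneg: "0 \<le> clip x" and clip_le_1: "clip x \<le> 1"
  by (auto simp: clip_def)

lemma clip_mono: "x \<le> y \<Longrightarrow> clip x \<le> clip y"
  by (auto simp: clip_def)

lemma clip_lipschitz: "\<bar>clip x - clip y\<bar> \<le> \<bar>x - y\<bar>"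
  unfolding clip_def by linarith

lemma continuous_on_clip [continuous_intros]:
  "continuous_on S g \<Longrightarrow> continuous_on S (\<lambda>x. clip (g x))"
  unfolding clip_def by (intro continuous_intros)

text \<open>Away from its kinks 0 and 1 the clip is affine, so its first-order remainder vanishes
  unless a kink is within \<open>\<bar>\<eta>\<bar>\<close> of \<open>u\<close>. Integrating over
  these two narrow bands supplies a second factor of order
  \<open>\<bar>\<eta>\<bar>\<close>.\<close>

lemma clip_remainder:
  "\<bar>clip (u + \<eta>) - clip u - (if 0 \<le> u \<and> u \<le> 1 then \<eta> else 0)\<bar>
     \<le> \<bar>\<eta>\<bar> * ((if \<bar>u\<bar> \<le> \<bar>\<eta>\<bar> then 1 else 0) + (if \<bar>u - 1\<bar> \<le> \<bar>\<eta>\<bar> then 1 else 0))"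
proof -
  have clip: "clip x = (if x \<le> 0 then 0 else if x \<le> 1 then x else 1)" for x
    by (simp add: clip_def)
  define r where "r = clip (u + \<eta>) - clip u - (if 0 \<le> u \<and> u \<le> 1 then \<eta> else 0)"
  have "r \<le> \<bar>\<eta>\<bar>" "- r \<le> \<bar>\<eta>\<bar>"
    unfolding r_def clip by auto
  then have "\<bar>r\<bar> \<le> \<bar>\<eta>\<bar>" by simp
  moreover have "r = 0" if "\<bar>u\<bar> > \<bar>\<eta>\<bar>" "\<bar>u - 1\<bar> > \<bar>\<eta>\<bar>"
    using that unfolding r_def clip by auto
  ultimately show ?thesis
    unfolding r_def[symmetric] by (cases "\<bar>u\<bar> \<le> \<bar>\<eta>\<bar>"; cases "\<bar>u - 1\<bar> \<le> \<bar>\<eta>\<bar>") auto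
qed

lemma integral_affine_band_le:
  fixes a b w s d :: real
  assumes "w > 0" "d \<ge> 0"
  shows "(\<lambda>x. if \<bar>w * x + s\<bar> \<le> d then 1 else 0 :: real) integrable_on {a..b}"
    and "integral {a..b} (\<lambda>x. if \<bar>w * x + s\<bar> \<le> d then 1 else 0 :: real) \<le> 2 * d / w"
proof -
  let ?J = "{(- s - d) / w..(- s + d) / w}"
  have band: "\<bar>w * x + s\<bar> \<le> d \<longleftrightarrow> x \<in> ?J" for x
    using assms by (auto simp: field_simps abs_le_iff)
  have J: "((\<lambda>x. 1 :: real) has_integral 2 * d / w) ?J"
    using has_integral_const_real[of "1::real" "(- s - d) / w" "(- s + d) / w"] assms
    by (simp add: divide_right_mono diff_divide_distrib add_divide_distrib)
  have U: "((\<lambda>x. if \<bar>w * x + s\<bar> \<le> d then 1 else 0 :: real) has_integral 2 * d / w) UNIV"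
    unfolding band using has_integral_restrict_UNIV[of ?J "\<lambda>x. 1 :: real"] J by simp
  show int: "(\<lambda>x. if \<bar>w * x + s\<bar> \<le> d then 1 else 0 :: real) integrable_on {a..b}"
    using integrable_on_subinterval[OF has_integral_integrable[OF U]] by simp
  show "integral {a..b} (\<lambda>x. if \<bar>w * x + s\<bar> \<le> d then 1 else 0 :: real) \<le> 2 * d / w"
    using integral_subset_le[OF subset_UNIV int has_integral_integrable[OF U]] integral_unique[OF U]
    by simp
qed

text \<open>Shifting the bias changes the clip at unit rate exactly where it is affine, which gives
  the linear term. The remainder is at most \<open>K * \<bar>\<eta>\<bar>\<close> on two bands of
  length at most \<open>2 * \<bar>\<eta>\<bar> / w\<close> each, whence the constant
  \<open>4 * K / w\<close>.\<close>

lemma clip_integral_remainder: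
  fixes a b w s \<eta> K :: real and k :: "real \<Rightarrow> real"
  assumes ab: "a < b" and w: "w > 0" and k: "continuous_on {a..b} k"
    and K: "\<And>x. x \<in> {a..b} \<Longrightarrow> \<bar>k x\<bar> \<le> K"
  shows "\<bar>integral {a..b} (\<lambda>x. (clip (w * x + (s + \<eta>)) - clip (w * x + s)) * k x)
      - \<eta> * integral {max a (min b (- (1 / w) * s))..max a (min b (- (1 / w) * s + 1 / w))} k\<bar>
      \<le> 4 * K / w * \<eta>\<^sup>2" (is "\<bar>?L - \<eta> * integral {?l..?h} k\<bar> \<le> _")
proof -
  let ?B0 = "\<lambda>x. if \<bar>w * x + s\<bar> \<le> \<bar>\<eta>\<bar> then 1 else 0 :: real"
  let ?B1 = "\<lambda>x. if \<bar>w * x + (s - 1)\<bar> \<le> \<bar>\<eta>\<bar> then 1 else 0 :: real"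
  let ?r = "\<lambda>x. if x \<in> {?l..?h} then k x else 0"
  have K0: "K \<ge> 0" using K[of a] ab by force
  have sub: "{?l..?h} \<subseteq> {a..b}" using ab by auto
  have kint: "k integrable_on {?l..?h}"
    using integrable_continuous_real continuous_on_subset[OF k sub] by blast
  then have r: "(?r has_integral integral {?l..?h} k) {a..b}"
    using has_integral_restrict[OF sub] by blast
  have i1: "(\<lambda>x. (clip (w * x + (s + \<eta>)) - clip (w * x + s)) * k x) integrable_on {a..b}"
    by (intro integrable_continuous_real continuous_intros k)
  have i2: "(\<lambda>x. \<eta> * ?r x) integrable_on {a..b}"
    using r by (intro integrable_on_mult_right) blast
  have B: "?B0 integrable_on {a..b}" "?B1 integrable_on {a..b}"
    using integral_affine_band_le(1)[OF w, of "\<bar>\<eta>\<bar>"] by auto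
  \<comment> \<open>Only the open interval is used: if the affine range of the clip lies outside
    \<open>{a..b}\<close>, clamping leaves the single point \<open>a\<close> or \<open>b\<close>,
    where the indicator in \<open>?r\<close> would be wrong. The end points are a null set.\<close>
  have pt: "norm ((clip (w * x + (s + \<eta>)) - clip (w * x + s)) * k x - \<eta> * ?r x)
      \<le> K * \<bar>\<eta>\<bar> * (?B0 x + ?B1 x)" if x: "x \<in> {a<..<b}" for x
  proof -
    have "x \<in> {?l..?h} \<longleftrightarrow> - (1 / w) * s \<le> x \<and> x \<le> - (1 / w) * s + 1 / w"
      using x by auto
    also have "\<dots> \<longleftrightarrow> 0 \<le> w * x + s \<and> w * x + s \<le> 1"
      using w by (auto simp: field_simps)
    finally have eq: "(clip (w * x + (s + \<eta>)) - clip (w * x + s)) * k x - \<eta> * ?r x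
       = (clip ((w * x + s) + \<eta>) - clip (w * x + s)
           - (if 0 \<le> w * x + s \<and> w * x + s \<le> 1 then \<eta> else 0)) * k x"
      by (simp add: add.assoc left_diff_distrib)
    have "\<bar>clip ((w * x + s) + \<eta>) - clip (w * x + s)
           - (if 0 \<le> w * x + s \<and> w * x + s \<le> 1 then \<eta> else 0)\<bar> * \<bar>k x\<bar>
        \<le> (\<bar>\<eta>\<bar> * (?B0 x + ?B1 x)) * K"
    proof (rule mult_mono)
      show "\<bar>k x\<bar> \<le> K" using K x by simp
      have "0 \<le> ?B0 x + ?B1 x" by simp
      then show "0 \<le> \<bar>\<eta>\<bar> * (?B0 x + ?B1 x)" by (rule mult_nonneg_nonneg[OF abs_ge_zero])
    qed (use clip_remainder[of "w * x + s" \<eta>] in \<open>simp_all only: add_diff_eq abs_ge_zero\<close>)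
    then show ?thesis
      unfolding eq real_norm_def abs_mult by (simp only: mult_ac)
  qed
  let ?F = "\<lambda>x. (clip (w * x + (s + \<eta>)) - clip (w * x + s)) * k x - \<eta> * ?r x"
  have "?L - \<eta> * integral {?l..?h} k = integral {a<..<b} ?F"
    unfolding integral_open_interval_real[of a b ?F, symmetric]
      integral_diff[OF i1 i2] integral_mult_right integral_unique[OF r] by (rule refl)
  then have "\<bar>?L - \<eta> * integral {?l..?h} k\<bar> = norm (integral {a<..<b} ?F)"
    by (simp only: real_norm_def)
  also have "norm (integral {a<..<b} ?F)
      \<le> integral {a<..<b} (\<lambda>x. K * \<bar>\<eta>\<bar> * (?B0 x + ?B1 x))"
  proof (rule integral_norm_bound_integral[OF _ _ pt])
    show "(\<lambda>x. (clip (w * x + (s + \<eta>)) - clip (w * x + s)) * k x - \<eta> * ?r x)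
        integrable_on {a<..<b}"
      unfolding integrable_on_open_interval_real by (rule integrable_diff[OF i1 i2])
    show "(\<lambda>x. K * \<bar>\<eta>\<bar> * (?B0 x + ?B1 x)) integrable_on {a<..<b}"
      unfolding integrable_on_open_interval_real
      by (rule integrable_on_mult_right[OF integrable_add[OF B]])
  qed
  also have "\<dots> = integral {a..b} (\<lambda>x. K * \<bar>\<eta>\<bar> * (?B0 x + ?B1 x))"
    by (rule integral_open_interval_real[symmetric])
  also have "\<dots> = K * \<bar>\<eta>\<bar> * (integral {a..b} ?B0 + integral {a..b} ?B1)"
    unfolding integral_mult_right integral_add[OF B] by (rule refl)
  also have "\<dots> \<le> K * \<bar>\<eta>\<bar> * (2 * \<bar>\<eta>\<bar> / w + 2 * \<bar>\<eta>\<bar> / w)"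
    by (intro mult_left_mono add_mono integral_affine_band_le(2)[OF w abs_ge_zero]
        mult_nonneg_nonneg K0 abs_ge_zero)
  also have "\<dots> = 4 * K / w * (\<bar>\<eta>\<bar> * \<bar>\<eta>\<bar>)"
    by (simp add: field_simps del: abs_mult_self_eq)
  also have "\<dots> = 4 * K / w * \<eta>\<^sup>2"
    by (simp only: abs_mult_self_eq power2_eq_square)
  finally show ?thesis .
qed

text \<open>The affine substitution moves the moving end points of the interval into the integrand,
  where joint continuity suffices.\<close>

lemma integral_to_unit_interval:
  fixes l h :: real and k :: "real \<Rightarrow> real"
  assumes k: "continuous_on {l..h} k" and "l \<le> h"
  shows "integral {l..h} k = (h - l) * integral {0..1} (\<lambda>r. k (l + r * (h - l)))"
proof (cases "l = h")
  case False
  then have lh: "l < h" using assms by simp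
  have "(k has_integral integral {l..h} k) (cbox l h)"
    using integrable_integral[OF integrable_continuous_real[OF k]] by simp
  from has_integral_affinity[OF this, of "h - l" l]
  have "((\<lambda>r. k ((h - l) * r + l)) has_integral (1 / (h - l)) * integral {l..h} k)
     ((\<lambda>x. (1 / (h - l)) * x + - ((1 / (h - l)) * l)) ` {l..h})"
    using lh by simp
  also have "(\<lambda>x. (1 / (h - l)) * x + - ((1 / (h - l)) * l)) ` {l..h} = {0..1}"
    unfolding image_affinity_atLeastAtMost
    using lh by (auto simp: diff_divide_distrib[symmetric])
  finally have "integral {0..1} (\<lambda>r. k ((h - l) * r + l)) = integral {l..h} k / (h - l)"
    by (simp add: integral_unique)
  moreover have "(h - l) * r + l = l + r * (h - l)" for r
    by simp
  ultimately show ?thesis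
    using lh by (simp only:) simp
qed simp

subsection \<open>The gradient of the loss\<close>

locale clipped_network =
  fixes a b :: real and v w :: "'h::finite \<Rightarrow> real" and f p :: "real \<Rightarrow> real"
  assumes ab: "a < b" and vpos: "\<And>i. v i > 0" and wpos: "\<And>i. w i > 0"
    and fcont: "continuous_on UNIV f" and pcont: "continuous_on UNIV p"
begin

definition residual :: "real ^ ('h option) \<Rightarrow> real \<Rightarrow> real" where
  "residual \<theta> x = (NN v w \<theta> x - f x) * p x"

text \<open>Clamping to \<open>{a..b}\<close> makes both end points continuous in the parameters and
  collapses an interval outside the domain to a point, over which every integral is 0.\<close>

definition lo :: "'h \<Rightarrow> real ^ ('h option) \<Rightarrow> real" where
  "lo i \<theta> = max a (min b (psi w i \<theta>))"

definition hi :: "'h \<Rightarrow> real ^ ('h option) \<Rightarrow> real" where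
  "hi i \<theta> = max a (min b (psi w i \<theta> + 1 / w i))"

text \<open>The closed form obtained by formal differentiation under the integral;
  \<open>grad_eq\<close> identifies it with \<open>grad\<close> of the loss.\<close>

definition gradient :: "real ^ ('h option) \<Rightarrow> real ^ ('h option)" where
  "gradient \<theta> = (\<chi> j. case j of None \<Rightarrow> 2 * integral {a..b} (residual \<theta>)
     | Some i \<Rightarrow> 2 * v i * integral {lo i \<theta>..hi i \<theta>} (residual \<theta>))"

lemma lo_hi: "a \<le> lo i \<theta>" "lo i \<theta> \<le> hi i \<theta>" "hi i \<theta> \<le> b"
proof -
  have "psi w i \<theta> < psi w i \<theta> + 1 / w i" using wpos[of i] by simp
  then show "a \<le> lo i \<theta>" "lo i \<theta> \<le> hi i \<theta>" "hi i \<theta> \<le> b"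
    using ab unfolding lo_def hi_def by linarith+
qed

lemma Iset_eq: "Iset a b w i \<theta> = {lo i \<theta><..<hi i \<theta>}"
  using ab wpos[of i] unfolding lo_def hi_def Iset_def by auto

lemma cont_NN [continuous_intros]:
  "continuous_on S g \<Longrightarrow> continuous_on S r \<Longrightarrow> continuous_on S (\<lambda>x. NN v w (g x) (r x))"
  unfolding NN_def by (intro continuous_intros)

lemma cont_f [continuous_intros]: "continuous_on S g \<Longrightarrow> continuous_on S (\<lambda>x. f (g x))"
  by (rule continuous_on_compose2[OF fcont]) auto

lemma cont_p [continuous_intros]: "continuous_on S g \<Longrightarrow> continuous_on S (\<lambda>x. p (g x))"
  by (rule continuous_on_compose2[OF pcont]) auto

lemma cont_residual [continuous_intros]:
  "continuous_on S g \<Longrightarrow> continuous_on S r \<Longrightarrow> continuous_on S (\<lambda>x. residual (g x) (r x))"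
  unfolding residual_def by (intro continuous_intros)

lemma cont_residual1: "continuous_on S (residual \<theta>)"
  by (intro continuous_intros)

lemma sum_option: "(\<Sum>j\<in>UNIV. g j) = g None + (\<Sum>i\<in>UNIV. g (Some i))"
  for g :: "'h option \<Rightarrow> real"
  by (simp add: UNIV_option_conv sum.reindex)

text \<open>With \<open>D\<close> the increment of the network, the loss changes by the integral of
  \<open>2 * residual * D\<close> plus that of \<open>D\<^sup>2 * p\<close>. The first is linear in
  the clip increments, so \<open>clip_integral_remainder\<close> applies to each neuron; the second
  is quadratic because \<open>D\<close> is Lipschitz in the parameters.\<close>

lemma has_derivative_loss:
  "(loss a b f p v w has_derivative (\<lambda>\<eta>. gradient \<theta> \<bullet> \<eta>)) (at \<theta>)"
proof -
  obtain K where K: "\<And>x. x \<in> {a..b} \<Longrightarrow> \<bar>residual \<theta> x\<bar> \<le> K"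
  proof -
    have "bounded (residual \<theta> ` {a..b})"
      by (intro compact_imp_bounded compact_continuous_image cont_residual1) simp
    then obtain K where "\<forall>x\<in>{a..b}. \<bar>residual \<theta> x\<bar> \<le> K" by (auto simp: bounded_iff)
    then show ?thesis using that by blast
  qed
  \<comment> \<open>\<open>M\<close> is a Lipschitz constant of the network in its parameters,
    uniform in \<open>x\<close>; \<open>C\<close> adds the remainders of the neurons to the bound
    for the square of \<open>D\<close>.\<close>
  define M where "M = 1 + (\<Sum>i\<in>UNIV. v i)"
  define P where "P = integral {a..b} (\<lambda>x. \<bar>p x\<bar>)"
  define C where "C = (\<Sum>i\<in>UNIV. 2 * v i * (4 * K / w i)) + M\<^sup>2 * P"
  have K0: "K \<ge> 0" using K[of a] ab by force
  have "\<bar>loss a b f p v w (\<theta> + \<eta>) - loss a b f p v w \<theta> - gradient \<theta> \<bullet> \<eta>\<bar> \<le> C * (norm \<eta>)\<^sup>2" for \<eta>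
  proof -
    let ?d = "\<lambda>i x. clip (w i * x + (\<theta> $ Some i + \<eta> $ Some i)) - clip (w i * x + \<theta> $ Some i)"
    define D where "D x = NN v w (\<theta> + \<eta>) x - NN v w \<theta> x" for x
    have D: "D x = \<eta> $ None + (\<Sum>i\<in>UNIV. v i * ?d i x)" for x
      by (simp add: D_def NN_def sum_subtractf right_diff_distrib)
    have cD: "continuous_on {a..b} D" unfolding D_def by (intro continuous_intros)
    have nrm: "\<bar>\<eta> $ j\<bar> \<le> norm \<eta>" for j using component_le_norm_cart[of \<eta> j] by simp
    have Dle: "\<bar>D x\<bar> \<le> M * norm \<eta>" for x
    proof -
      have "\<bar>\<Sum>i\<in>UNIV. v i * ?d i x\<bar> \<le> (\<Sum>i\<in>UNIV. v i * norm \<eta>)"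
      proof (rule order_trans[OF sum_abs], rule sum_mono)
        fix i
        have "\<bar>?d i x\<bar> \<le> norm \<eta>"
          using clip_lipschitz[of "w i * x + (\<theta> $ Some i + \<eta> $ Some i)" "w i * x + \<theta> $ Some i"]
            nrm[of "Some i"] by simp
        then show "\<bar>v i * ?d i x\<bar> \<le> v i * norm \<eta>"
          unfolding abs_mult using vpos[of i] by (simp add: mult_left_mono)
      qed
      then show ?thesis
        unfolding D M_def distrib_right sum_distrib_right using nrm[of None] by linarith
    qed
    have i1: "(\<lambda>x. 2 * (residual \<theta> x * D x)) integrable_on {a..b}"
      and i2: "(\<lambda>x. (D x)\<^sup>2 * p x) integrable_on {a..b}"
      by (intro integrable_continuous_real continuous_intros cD cont_residual1)+
    have i3: "(\<lambda>x. (NN v w (\<theta> + \<eta>) x - f x)\<^sup>2 * p x) integrable_on {a..b}"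
      and i4: "(\<lambda>x. (NN v w \<theta> x - f x)\<^sup>2 * p x) integrable_on {a..b}"
      and i5: "\<And>i. (\<lambda>x. ?d i x * residual \<theta> x) integrable_on {a..b}"
      and i6: "residual \<theta> integrable_on {a..b}"
      by (intro integrable_continuous_real continuous_intros)+
    have "loss a b f p v w (\<theta> + \<eta>) - loss a b f p v w \<theta>
        = integral {a..b} (\<lambda>x. 2 * (residual \<theta> x * D x) + (D x)\<^sup>2 * p x)"
      unfolding loss_def integral_diff[OF i3 i4, symmetric]
      by (intro integral_cong) (simp add: D_def residual_def power2_eq_square algebra_simps)
    also have "\<dots> = integral {a..b} (\<lambda>x. 2 * (residual \<theta> x * D x))
        + integral {a..b} (\<lambda>x. (D x)\<^sup>2 * p x)"
      by (rule integral_add[OF i1 i2])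
    also have "integral {a..b} (\<lambda>x. 2 * (residual \<theta> x * D x))
        = integral {a..b} (\<lambda>x. 2 * \<eta> $ None * residual \<theta> x
            + (\<Sum>i\<in>UNIV. 2 * v i * (?d i x * residual \<theta> x)))"
      unfolding D by (intro integral_cong) (simp add: sum_distrib_left algebra_simps)
    also have "\<dots> = 2 * \<eta> $ None * integral {a..b} (residual \<theta>)
        + (\<Sum>i\<in>UNIV. 2 * v i * integral {a..b} (\<lambda>x. ?d i x * residual \<theta> x))"
    proof -
      have j1: "(\<lambda>x. 2 * \<eta> $ None * residual \<theta> x) integrable_on {a..b}"
        by (rule integrable_on_mult_right[OF i6])
      have j2: "(\<lambda>x. 2 * v i * (?d i x * residual \<theta> x)) integrable_on {a..b}" for i
        by (rule integrable_on_mult_right[OF i5])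
      have j3: "(\<lambda>x. \<Sum>i\<in>UNIV. 2 * v i * (?d i x * residual \<theta> x)) integrable_on {a..b}"
        by (rule integrable_sum) (auto intro: j2)
      show ?thesis
        unfolding integral_add[OF j1 j3] integral_sum[OF finite j2] integral_mult_right by (rule refl)
    qed
    finally have eq: "loss a b f p v w (\<theta> + \<eta>) - loss a b f p v w \<theta> - gradient \<theta> \<bullet> \<eta>
       = (\<Sum>i\<in>UNIV. 2 * v i * (integral {a..b} (\<lambda>x. ?d i x * residual \<theta> x)
             - \<eta> $ Some i * integral {lo i \<theta>..hi i \<theta>} (residual \<theta>)))
          + integral {a..b} (\<lambda>x. (D x)\<^sup>2 * p x)"
      by (simp add: inner_vec_def sum_option gradient_def sum_subtractf right_diff_distrib algebra_simps)
    have "\<bar>loss a b f p v w (\<theta> + \<eta>) - loss a b f p v w \<theta> - gradient \<theta> \<bullet> \<eta>\<bar>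
       \<le> (\<Sum>i\<in>UNIV. 2 * v i * (4 * K / w i) * (norm \<eta>)\<^sup>2) + M\<^sup>2 * P * (norm \<eta>)\<^sup>2"
      unfolding eq
    proof (rule order_trans[OF abs_triangle_ineq], rule add_mono)
      show "\<bar>\<Sum>i\<in>UNIV. 2 * v i * (integral {a..b} (\<lambda>x. ?d i x * residual \<theta> x)
             - \<eta> $ Some i * integral {lo i \<theta>..hi i \<theta>} (residual \<theta>))\<bar>
          \<le> (\<Sum>i\<in>UNIV. 2 * v i * (4 * K / w i) * (norm \<eta>)\<^sup>2)"
      proof (rule order_trans[OF sum_abs], rule sum_mono)
        fix i
        have "\<bar>integral {a..b} (\<lambda>x. ?d i x * residual \<theta> x)
             - \<eta> $ Some i * integral {lo i \<theta>..hi i \<theta>} (residual \<theta>)\<bar>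
            \<le> 4 * K / w i * (\<eta> $ Some i)\<^sup>2"
          unfolding lo_def hi_def psi_def
          by (rule clip_integral_remainder[OF ab wpos cont_residual1 K])
        also have "\<dots> \<le> (4 * K / w i) * (norm \<eta>)\<^sup>2"
          using power_mono[OF nrm[of "Some i"], of 2] K0 wpos[of i] by (intro mult_left_mono) auto
        finally have *: "2 * v i * \<bar>integral {a..b} (\<lambda>x. ?d i x * residual \<theta> x)
             - \<eta> $ Some i * integral {lo i \<theta>..hi i \<theta>} (residual \<theta>)\<bar>
            \<le> 2 * v i * ((4 * K / w i) * (norm \<eta>)\<^sup>2)"
          using vpos[of i] by (intro mult_left_mono) auto
        have "\<bar>2 * v i * x\<bar> = 2 * v i * \<bar>x\<bar>" for x
          using vpos[of i] by (simp add: abs_mult)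
        with * show "\<bar>2 * v i * (integral {a..b} (\<lambda>x. ?d i x * residual \<theta> x)
             - \<eta> $ Some i * integral {lo i \<theta>..hi i \<theta>} (residual \<theta>))\<bar>
            \<le> 2 * v i * (4 * K / w i) * (norm \<eta>)\<^sup>2"
          by (simp only: mult.assoc)
      qed
      have "norm (integral {a..b} (\<lambda>x. (D x)\<^sup>2 * p x))
          \<le> integral {a..b} (\<lambda>x. (M * norm \<eta>)\<^sup>2 * \<bar>p x\<bar>)"
      proof (rule integral_norm_bound_integral[OF i2])
        show "(\<lambda>x. (M * norm \<eta>)\<^sup>2 * \<bar>p x\<bar>) integrable_on {a..b}"
          by (intro integrable_continuous_real continuous_intros)
        show "norm ((D x)\<^sup>2 * p x) \<le> (M * norm \<eta>)\<^sup>2 * \<bar>p x\<bar>" for x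
          using power_mono[OF Dle[of x], of 2] by (simp add: abs_mult mult_right_mono)
      qed
      then show "\<bar>integral {a..b} (\<lambda>x. (D x)\<^sup>2 * p x)\<bar> \<le> M\<^sup>2 * P * (norm \<eta>)\<^sup>2"
        by (simp add: P_def power_mult_distrib mult_ac)
    qed
    also have "\<dots> = C * (norm \<eta>)\<^sup>2"
      unfolding C_def distrib_right sum_distrib_right by (rule refl)
    finally show ?thesis .
  qed
  then show ?thesis
    by (rule has_derivative_quadratic_remainder[OF bounded_linear_inner_right])
qed

lemma grad_eq: "grad (loss a b f p v w) \<theta> = gradient \<theta>"
  unfolding grad_def frechet_derivative_at[OF has_derivative_loss, symmetric]
  by (simp add: vec_eq_iff inner_axis)

lemma cont_gradient: "continuous_on UNIV gradient"
proof -
  have "continuous_on UNIV (\<lambda>\<theta>. gradient \<theta> $ j)" for j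
  proof (cases j)
    case None
    have "continuous_on (UNIV \<times> cbox a b) (\<lambda>(\<theta>, x). residual \<theta> x)"
      unfolding split_def by (intro continuous_intros)
    from integral_continuous_on_param[OF this] show ?thesis
      by (auto simp: None gradient_def intro!: continuous_intros)
  next
    case (Some i)
    have L: "continuous_on S (\<lambda>x. lo i (g x))" and H: "continuous_on S (\<lambda>x. hi i (g x))"
      if "continuous_on S g" for g :: "'x::topological_space \<Rightarrow> real ^ ('h option)" and S
      unfolding lo_def hi_def psi_def by (intro continuous_intros that)+
    have "continuous_on (UNIV \<times> cbox 0 1)
        (\<lambda>(\<theta>, r). residual \<theta> (lo i \<theta> + r * (hi i \<theta> - lo i \<theta>)))"
      unfolding split_def by (intro continuous_intros L H)
    note * = integral_continuous_on_param[OF this]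
    have "integral {lo i \<theta>..hi i \<theta>} (residual \<theta>) = (hi i \<theta> - lo i \<theta>)
       * integral {0..1} (\<lambda>r. residual \<theta> (lo i \<theta> + r * (hi i \<theta> - lo i \<theta>)))" for \<theta>
      by (rule integral_to_unit_interval[OF cont_residual1 lo_hi(2)])
    then show ?thesis
      using * by (auto simp: Some gradient_def intro!: continuous_intros L H)
  qed
  then have "continuous_on UNIV (\<lambda>\<theta>. \<chi> j. gradient \<theta> $ j)"
    by (intro continuous_on_vec_lambda)
  then show ?thesis by simp
qed

end

subsection \<open>Critical points\<close>

locale steep_network = clipped_network a b v w f p
  for a b :: real and v w :: "'h::finite \<Rightarrow> real" and f p :: "real \<Rightarrow> real" +
  assumes pnn: "\<And>x. p x \<ge> 0" and psupp: "{x. p x > 0} = {a<..<b}"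
    and fmono: "mono f" and flip: "Lip a b f < ereal (Min ((\<lambda>i. v i * w i) ` UNIV))"
begin

definition err :: "real ^ ('h option) \<Rightarrow> real \<Rightarrow> real" where
  "err \<theta> x = NN v w \<theta> x - f x"

definition active :: "real ^ ('h option) \<Rightarrow> 'h set" where
  "active \<theta> = {i. lo i \<theta> < hi i \<theta>}"

text \<open>At the limit point this is the constant V of the theorem.\<close>

definition overlap :: "real ^ ('h option) \<Rightarrow> real" where
  "overlap \<theta> = (SUP x\<in>{a<..<b}. (\<Sum>i\<in>{i. x \<in> Iset a b w i \<theta>}. v i))"

lemma f_le: "x \<le> y \<Longrightarrow> f x \<le> f y"
  using fmono by (rule monoD)

lemma psi_scaled: "w i * psi w i \<theta> = - \<theta> $ Some i"
  using wpos[of i] by (simp add: psi_def)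

section \<open>Active neurons and the rise of the network over a segment\<close>

lemma active_psi:
  assumes "i \<in> active \<theta>"
  shows "psi w i \<theta> \<le> lo i \<theta>" "hi i \<theta> \<le> psi w i \<theta> + 1 / w i" "psi w i \<theta> < b"
    "a < psi w i \<theta> + 1 / w i"
  using assms ab unfolding active_def lo_def hi_def by (auto simp: max_def min_def split: if_splits)

lemma active_band:
  assumes "i \<in> active \<theta>" "lo i \<theta> \<le> x" "x \<le> hi i \<theta>"
  shows "clip (w i * x + \<theta> $ Some i) = w i * x + \<theta> $ Some i"
proof -
  have "psi w i \<theta> \<le> x" "x \<le> psi w i \<theta> + 1 / w i"
    using active_psi(1,2)[OF assms(1)] assms(2,3) by linarith+
  then have "w i * psi w i \<theta> \<le> w i * x" "w i * x \<le> w i * (psi w i \<theta> + 1 / w i)"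
    using wpos[of i] by (simp_all add: mult_left_mono)
  then show ?thesis
    using wpos[of i] by (simp add: psi_scaled distrib_left clip_def)
qed

text \<open>A change of the clip needs a positive argument at \<open>y\<close> and an argument below
  1 at \<open>x\<close>, so the interval of the neuron meets the segment.\<close>

lemma clip_change_active:
  assumes "a \<le> x" "x \<le> y" "y \<le> b"
    and ne: "clip (w i * x + \<theta> $ Some i) \<noteq> clip (w i * y + \<theta> $ Some i)"
  shows "i \<in> active \<theta>" "lo i \<theta> < y" "x < hi i \<theta>"
proof -
  have "x < y" using assms by (cases "x = y") auto
  have le: "w i * x \<le> w i * y" using assms wpos[of i] by simp
  have "0 < w i * y + \<theta> $ Some i" "w i * x + \<theta> $ Some i < 1"
    using ne le by (auto simp: clip_def not_less[symmetric])
  then have "psi w i \<theta> < y" "x < psi w i \<theta> + 1 / w i"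
    using wpos[of i] by (auto simp: psi_def field_simps)
  moreover have "psi w i \<theta> < psi w i \<theta> + 1 / w i" using wpos[of i] by simp
  ultimately show "i \<in> active \<theta>" "lo i \<theta> < y" "x < hi i \<theta>"
    using \<open>x < y\<close> assms ab unfolding active_def lo_def hi_def by auto
qed

lemma NN_diff: "NN v w \<theta> y - NN v w \<theta> x
    = (\<Sum>i\<in>UNIV. v i * (clip (w i * y + \<theta> $ Some i) - clip (w i * x + \<theta> $ Some i)))"
  by (simp add: NN_def sum_subtractf right_diff_distrib)

lemma clip_affine_mono:
  "x \<le> y \<Longrightarrow> 0 \<le> clip (w i * y + \<theta> $ Some i) - clip (w i * x + \<theta> $ Some i)"
  using clip_mono[of "w i * x + \<theta> $ Some i" "w i * y + \<theta> $ Some i"] wpos[of i] by simp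

lemma NN_mono: "x \<le> y \<Longrightarrow> NN v w \<theta> x \<le> NN v w \<theta> y"
proof -
  assume "x \<le> y"
  then have "0 \<le> NN v w \<theta> y - NN v w \<theta> x"
    unfolding NN_diff using vpos
    by (intro sum_nonneg mult_nonneg_nonneg clip_affine_mono) (auto simp: less_imp_le)
  then show ?thesis by simp
qed

text \<open>A clip changes by at most 1, so a neuron contributes at most its height, and only if its
  interval meets the segment.\<close>

lemma NN_rise_le:
  assumes "a \<le> x" "x \<le> y" "y \<le> b"
    and S: "\<And>i. i \<in> active \<theta> \<Longrightarrow> lo i \<theta> < y \<Longrightarrow> x < hi i \<theta> \<Longrightarrow> i \<in> S"
  shows "NN v w \<theta> y - NN v w \<theta> x \<le> sum v S"
proof -
  have "NN v w \<theta> y - NN v w \<theta> x \<le> (\<Sum>i\<in>UNIV. if i \<in> S then v i else 0)"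
    unfolding NN_diff
  proof (rule sum_mono)
    fix i
    show "v i * (clip (w i * y + \<theta> $ Some i) - clip (w i * x + \<theta> $ Some i))
        \<le> (if i \<in> S then v i else 0)"
    proof (cases "clip (w i * x + \<theta> $ Some i) = clip (w i * y + \<theta> $ Some i)")
      case True
      then show ?thesis using vpos[of i] by simp
    next
      case False
      then have "i \<in> S" using S clip_change_active[OF assms(1-3)] by blast
      moreover have "clip (w i * y + \<theta> $ Some i) - clip (w i * x + \<theta> $ Some i) \<le> 1"
        using clip_nonneg[of "w i * x + \<theta> $ Some i"] clip_le_1[of "w i * y + \<theta> $ Some i"] by linarith
      ultimately show ?thesis using vpos[of i] by (simp add: mult_left_le)
    qed
  qed
  then show ?thesis by (simp add: sum.If_cases)
qed

lemma NN_const: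
  assumes "a \<le> x" "x \<le> y" "y \<le> b"
    and "\<And>i. i \<in> active \<theta> \<Longrightarrow> lo i \<theta> < y \<Longrightarrow> x < hi i \<theta> \<Longrightarrow> False"
  shows "NN v w \<theta> y = NN v w \<theta> x"
proof -
  have "NN v w \<theta> y - NN v w \<theta> x \<le> sum v {}"
    by (rule NN_rise_le[OF assms(1-3)]) (use assms(4) in blast)
  then show ?thesis using NN_mono[OF assms(2), of \<theta>] by simp
qed

text \<open>Bounds by \<open>overlap\<close> are obtained through this: it suffices to exhibit one
  point of the domain common to all the intervals.\<close>

lemma sum_le_overlap:
  assumes "a < x" "x < b" and S: "\<And>i. i \<in> S \<Longrightarrow> lo i \<theta> < x \<and> x < hi i \<theta>"
  shows "sum v S \<le> overlap \<theta>"
proof -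
  have v0: "\<And>i. v i \<ge> 0" using vpos by (simp add: less_imp_le)
  have "sum v S \<le> (\<Sum>i\<in>{i. x \<in> Iset a b w i \<theta>}. v i)"
    by (rule sum_mono2) (auto simp: Iset_eq S v0)
  also have "\<dots> \<le> overlap \<theta>"
    unfolding overlap_def
  proof (rule cSUP_upper)
    show "bdd_above ((\<lambda>x. \<Sum>i\<in>{i. x \<in> Iset a b w i \<theta>}. v i) ` {a<..<b})"
      by (rule bdd_aboveI2[of _ _ "sum v UNIV"]) (auto intro!: sum_mono2 v0)
  qed (use assms in auto)
  finally show ?thesis .
qed

lemma overlap_nonneg: "0 \<le> overlap \<theta>"
  using sum_le_overlap[of "(a + b) / 2" "{}" \<theta>] ab by simp

lemma f_slope:
  assumes "a \<le> x" "x < y" "y \<le> b"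
  shows "f y - f x < v i * w i * (y - x)"
proof -
  have "ereal (\<bar>f y - f x\<bar> / \<bar>y - x\<bar>) \<le> Lip a b f"
    unfolding Lip_def using assms
    by (intro Sup_upper CollectI exI[of _ y] exI[of _ x]) auto
  also have "\<dots> < ereal (Min ((\<lambda>i. v i * w i) ` UNIV))" by (rule flip)
  also have "\<dots> \<le> ereal (v i * w i)" by simp
  finally have "\<bar>f y - f x\<bar> / \<bar>y - x\<bar> < v i * w i" by simp
  then have "\<bar>f y - f x\<bar> < v i * w i * (y - x)"
    using assms by (simp add: pos_divide_less_eq)
  then show ?thesis by linarith
qed

text \<open>On its interval neuron \<open>i\<close> alone has slope \<open>v i * w i\<close>, which
  exceeds every difference quotient of \<open>f\<close> on \<open>{a..b}\<close>; the other neurons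
  do not decrease.\<close>

lemma err_strict:
  assumes i: "i \<in> active \<theta>" and xy: "lo i \<theta> \<le> x" "x < y" "y \<le> hi i \<theta>"
  shows "err \<theta> x < err \<theta> y"
proof -
  have "v i * w i * (y - x) = v i * (clip (w i * y + \<theta> $ Some i) - clip (w i * x + \<theta> $ Some i))"
    using active_band[OF i] xy by (simp add: algebra_simps)
  also have "\<dots> \<le> NN v w \<theta> y - NN v w \<theta> x"
    unfolding NN_diff using vpos xy
    by (intro member_le_sum mult_nonneg_nonneg clip_affine_mono) (auto simp: less_imp_le)
  finally show ?thesis
    using f_slope[of x y i] lo_hi[of i \<theta>] xy unfolding err_def by linarith
qed

section \<open>Zeros and bounds of the error at a critical point\<close>

lemma critical_integrals:
  assumes "gradient \<theta> = 0"
  shows "integral {a..b} (residual \<theta>) = 0" "integral {lo i \<theta>..hi i \<theta>} (residual \<theta>) = 0"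
proof -
  have "gradient \<theta> $ None = 0" "gradient \<theta> $ Some i = 0" using assms by simp_all
  then show "integral {a..b} (residual \<theta>) = 0" "integral {lo i \<theta>..hi i \<theta>} (residual \<theta>) = 0"
    using vpos[of i] by (simp_all add: gradient_def)
qed

lemma residual_err: "residual \<theta> x = err \<theta> x * p x"
  by (simp add: residual_def err_def)

lemma cont_err: "continuous_on S (err \<theta>)"
  unfolding err_def by (intro continuous_intros continuous_on_id)

text \<open>A continuous function of one sign with integral zero vanishes identically. The midpoint
  is interior to the domain, so the density is positive there and can be cancelled; \<open>c\<close>
  treats both signs at once.\<close>

lemma integral_zero_imp_zero:
  fixes c :: real
  assumes "a \<le> l" "l < h" "h \<le> b" and c: "c = 1 \<or> c = -1"
    and int: "integral {l..h} (residual \<theta>) = 0"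
    and nn: "\<And>x. x \<in> {l..h} \<Longrightarrow> 0 \<le> c * err \<theta> x"
  shows "err \<theta> ((l + h) / 2) = 0"
proof -
  have "integral {l..h} (\<lambda>x. c * residual \<theta> x) = 0" using int by simp
  moreover have "continuous_on {l..h} (\<lambda>x. c * residual \<theta> x)"
    by (intro continuous_intros)
  moreover have "0 \<le> c * residual \<theta> x" if "x \<in> {l..h}" for x
    using mult_nonneg_nonneg[OF nn[OF that] pnn[of x]] by (simp add: residual_err mult.assoc)
  ultimately have "c * residual \<theta> ((l + h) / 2) = 0"
    using integral_eq_0_iff[of l h "\<lambda>x. c * residual \<theta> x"] \<open>l < h\<close> by auto
  moreover have "p ((l + h) / 2) > 0"
    using psupp assms(1-3) by (auto simp: set_eq_iff)
  ultimately show ?thesis using c by (auto simp: residual_err)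
qed

lemma active_zero:
  assumes i: "i \<in> active \<theta>" and crit: "gradient \<theta> = 0"
  obtains z where "lo i \<theta> < z" "z < hi i \<theta>" "err \<theta> z = 0"
proof -
  let ?l = "lo i \<theta>" and ?h = "hi i \<theta>"
  have lh: "a \<le> ?l" "?l < ?h" "?h \<le> b" using i lo_hi[of i \<theta>] by (auto simp: active_def)
  note zero = integral_zero_imp_zero[OF lh _ critical_integrals(2)[OF crit]]
  show ?thesis
  proof (cases "(\<forall>x\<in>{?l..?h}. 0 \<le> err \<theta> x) \<or> (\<forall>x\<in>{?l..?h}. err \<theta> x \<le> 0)")
    \<comment> \<open>Strict monotonicity in fact excludes a constant sign, but the midpoint already
      serves as the zero.\<close>
    case True
    then have "err \<theta> ((?l + ?h) / 2) = 0"
      using zero[of 1] zero[of "-1"] by auto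
    then show ?thesis using that[of "(?l + ?h) / 2"] lh by simp
  next
    case False
    then obtain x y where xy: "x \<in> {?l..?h}" "err \<theta> x < 0" "y \<in> {?l..?h}" "0 < err \<theta> y"
      by (auto simp: not_le)
    have "x < y"
    proof (rule ccontr)
      assume "\<not> x < y"
      then have "err \<theta> y \<le> err \<theta> x"
        using err_strict[OF i, of y x] xy by (cases "x = y") auto
      then show False using xy by simp
    qed
    obtain z where "x \<le> z" "z \<le> y" "err \<theta> z = 0"
      using IVT'[of "err \<theta>" x 0 y] xy \<open>x < y\<close> cont_err by (auto simp: less_imp_le)
    moreover have "z \<noteq> x" "z \<noteq> y" using xy \<open>err \<theta> z = 0\<close> by auto
    ultimately show ?thesis using that[of z] xy by auto
  qed
qed

text \<open>If the active intervals of two neurons meet, their zeros coincide, since the error is strictly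
  increasing on the union. Hence all intervals meeting the segment from the zero
  to a point of the same interval contain that zero, and the overlap bounds the rise of the network there.\<close>

lemma err_covered_le:
  assumes i: "i \<in> active \<theta>" and x: "lo i \<theta> \<le> x" "x \<le> hi i \<theta>" and crit: "gradient \<theta> = 0"
  shows "err \<theta> x \<le> overlap \<theta>"
proof -
  obtain z where z: "lo i \<theta> < z" "z < hi i \<theta>" "err \<theta> z = 0" using active_zero[OF i crit] .
  show ?thesis
  proof (cases "x \<le> z")
    case True
    then have "err \<theta> x \<le> 0" using err_strict[OF i, of x z] x z by (cases "x = z") auto
    then show ?thesis using overlap_nonneg[of \<theta>] by simp
  next
    case False
    then have zx: "z < x" by simp
    let ?S = "{j \<in> active \<theta>. lo j \<theta> < z \<and> z < hi j \<theta>}"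
    have "NN v w \<theta> x - NN v w \<theta> z \<le> sum v ?S"
    proof (rule NN_rise_le)
      fix j assume j: "j \<in> active \<theta>" "lo j \<theta> < x" "z < hi j \<theta>"
      \<comment> \<open>Otherwise \<open>lo j \<theta>\<close> lies in the interval of
        \<open>i\<close> at or after its zero \<open>z\<close>, so the error is nonnegative there
        and then positive at the zero of \<open>j\<close>.\<close>
      have "lo j \<theta> < z"
      proof (rule ccontr)
        assume "\<not> lo j \<theta> < z"
        obtain y where y: "lo j \<theta> < y" "y < hi j \<theta>" "err \<theta> y = 0" using active_zero[OF j(1) crit] .
        have "err \<theta> z \<le> err \<theta> (lo j \<theta>)"
          using err_strict[OF i, of z "lo j \<theta>"] z x j(2) \<open>\<not> lo j \<theta> < z\<close>
          by (cases "z = lo j \<theta>") auto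
        also have "\<dots> < err \<theta> y" using err_strict[OF j(1), of "lo j \<theta>" y] y by simp
        finally show False using y z by simp
      qed
      then show "j \<in> ?S" using j by simp
    qed (use z x lo_hi[of i \<theta>] zx in auto)
    also have "\<dots> \<le> overlap \<theta>"
      using z lo_hi[of i \<theta>] by (intro sum_le_overlap[of z]) auto
    finally show ?thesis using z(3) f_le[of z x] zx by (simp add: err_def)
  qed
qed

text \<open>Mirror image of \<open>err_covered_le\<close>, with the segment to the left of the
  zero.\<close>

lemma err_covered_ge:
  assumes i: "i \<in> active \<theta>" and x: "lo i \<theta> \<le> x" "x \<le> hi i \<theta>" and crit: "gradient \<theta> = 0"
  shows "- overlap \<theta> \<le> err \<theta> x"
proof -
  obtain z where z: "lo i \<theta> < z" "z < hi i \<theta>" "err \<theta> z = 0" using active_zero[OF i crit] .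
  show ?thesis
  proof (cases "z \<le> x")
    case True
    then have "0 \<le> err \<theta> x" using err_strict[OF i, of z x] x z by (cases "x = z") auto
    then show ?thesis using overlap_nonneg[of \<theta>] by simp
  next
    case False
    then have xz: "x < z" by simp
    let ?S = "{j \<in> active \<theta>. lo j \<theta> < z \<and> z < hi j \<theta>}"
    have "NN v w \<theta> z - NN v w \<theta> x \<le> sum v ?S"
    proof (rule NN_rise_le)
      fix j assume j: "j \<in> active \<theta>" "lo j \<theta> < z" "x < hi j \<theta>"
      have "z < hi j \<theta>"
      proof (rule ccontr)
        assume "\<not> z < hi j \<theta>"
        obtain y where y: "lo j \<theta> < y" "y < hi j \<theta>" "err \<theta> y = 0" using active_zero[OF j(1) crit] .
        have "err \<theta> y < err \<theta> (hi j \<theta>)" using err_strict[OF j(1), of y "hi j \<theta>"] y by simp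
        also have "\<dots> \<le> err \<theta> z"
          using err_strict[OF i, of "hi j \<theta>" z] z x j(3) \<open>\<not> z < hi j \<theta>\<close>
          by (cases "z = hi j \<theta>") auto
        finally show False using y z by simp
      qed
      then show "j \<in> ?S" using j by simp
    qed (use z x lo_hi[of i \<theta>] xz in auto)
    also have "\<dots> \<le> overlap \<theta>"
      using z lo_hi[of i \<theta>] by (intro sum_le_overlap[of z]) auto
    finally show ?thesis using z(3) f_le[of x z] xz by (simp add: err_def)
  qed
qed

text \<open>In a gap the network is constant since the last interval on the left ended, while
  \<open>f\<close> does not decrease. The bound at the right end of that interval therefore carries
  over to \<open>x\<close>.\<close>

lemma err_le_overlap:
  assumes j: "j \<in> active \<theta>" "lo j \<theta> \<le> x" and "x \<le> b" and crit: "gradient \<theta> = 0"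
  shows "err \<theta> x \<le> overlap \<theta>"
proof (cases "\<exists>i\<in>active \<theta>. lo i \<theta> \<le> x \<and> x \<le> hi i \<theta>")
  case True
  then show ?thesis using err_covered_le crit by blast
next
  case False
  let ?S = "{i \<in> active \<theta>. lo i \<theta> \<le> x}"
  obtain k where k: "k \<in> ?S" "\<And>i. i \<in> ?S \<Longrightarrow> hi i \<theta> \<le> hi k \<theta>"
    using ex_is_arg_min_if_finite[of ?S "\<lambda>i. - hi i \<theta>"] j
    unfolding is_arg_min_linorder by auto
  have kx: "hi k \<theta> \<le> x" using False k(1) by force
  have "NN v w \<theta> x = NN v w \<theta> (hi k \<theta>)"
    using lo_hi[of k \<theta>] kx \<open>x \<le> b\<close> k(2) by (intro NN_const) force+
  then have "err \<theta> x \<le> err \<theta> (hi k \<theta>)" using f_le[OF kx] by (simp add: err_def)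
  also have "\<dots> \<le> overlap \<theta>"
    using k(1) lo_hi[of k \<theta>] crit by (intro err_covered_le[of k]) auto
  finally show ?thesis .
qed

text \<open>Mirror image: the lower bound is carried leftwards from the next interval on the
  right.\<close>

lemma err_ge_overlap:
  assumes j: "j \<in> active \<theta>" "x \<le> hi j \<theta>" and "a \<le> x" and crit: "gradient \<theta> = 0"
  shows "- overlap \<theta> \<le> err \<theta> x"
proof (cases "\<exists>i\<in>active \<theta>. lo i \<theta> \<le> x \<and> x \<le> hi i \<theta>")
  case True
  then show ?thesis using err_covered_ge crit by blast
next
  case False
  let ?S = "{i \<in> active \<theta>. x \<le> hi i \<theta>}"
  obtain k where k: "k \<in> ?S" "\<And>i. i \<in> ?S \<Longrightarrow> lo k \<theta> \<le> lo i \<theta>"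
    using ex_is_arg_min_if_finite[of ?S "\<lambda>i. lo i \<theta>"] j
    unfolding is_arg_min_linorder by auto
  have kx: "x \<le> lo k \<theta>" using False k(1) by force
  have "NN v w \<theta> (lo k \<theta>) = NN v w \<theta> x"
    using lo_hi[of k \<theta>] kx \<open>a \<le> x\<close> k(2) by (intro NN_const) force+
  then have "err \<theta> (lo k \<theta>) \<le> err \<theta> x" using f_le[OF kx] by (simp add: err_def)
  moreover have "- overlap \<theta> \<le> err \<theta> (lo k \<theta>)"
    using k(1) lo_hi[of k \<theta>] crit by (intro err_covered_ge[of k]) auto
  ultimately show ?thesis by simp
qed

text \<open>Only neurons whose interval is cut off at an end point of [a, b] do not contribute their full
  height, and those share the points close to that end point.\<close>

lemma NN_total_rise:
  "(\<Sum>i\<in>active \<theta>. v i) - 2 * overlap \<theta> \<le> NN v w \<theta> b - NN v w \<theta> a"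
proof -
  let ?L = "{i \<in> active \<theta>. lo i \<theta> = a}" and ?R = "{i \<in> active \<theta>. hi i \<theta> = b}"
  have "(\<Sum>i\<in>active \<theta>. v i - (if lo i \<theta> = a then v i else 0) - (if hi i \<theta> = b then v i else 0))
      \<le> (\<Sum>i\<in>active \<theta>. v i * (clip (w i * b + \<theta> $ Some i) - clip (w i * a + \<theta> $ Some i)))"
  proof (rule sum_mono)
    fix i assume i: "i \<in> active \<theta>"
    let ?d = "clip (w i * b + \<theta> $ Some i) - clip (w i * a + \<theta> $ Some i)"
    have A: "clip (w i * a + \<theta> $ Some i) = 0" if "lo i \<theta> \<noteq> a"
    proof -
      have "a \<le> psi w i \<theta>" using that ab active_psi[OF i] by (auto simp: lo_def)
      then have "w i * a \<le> w i * psi w i \<theta>" using wpos[of i] by simp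
      then show ?thesis by (simp add: psi_scaled clip_def)
    qed
    have B: "clip (w i * b + \<theta> $ Some i) = 1" if "hi i \<theta> \<noteq> b"
    proof -
      have "psi w i \<theta> + 1 / w i \<le> b" using that ab active_psi[OF i] by (auto simp: hi_def)
      then have "w i * (psi w i \<theta> + 1 / w i) \<le> w i * b" using wpos[of i] by simp
      then show ?thesis using wpos[of i] by (simp add: distrib_left psi_scaled clip_def)
    qed
    have "0 \<le> ?d" using clip_affine_mono[of a b i \<theta>] ab by simp
    then have d: "(if lo i \<theta> = a \<or> hi i \<theta> = b then 0 else 1) \<le> ?d" using A B by auto
    \<comment> \<open>A neuron cut off at both ends is subtracted twice, which only weakens the
      bound.\<close>
    have "v i - (if lo i \<theta> = a then v i else 0) - (if hi i \<theta> = b then v i else 0)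
        \<le> v i * (if lo i \<theta> = a \<or> hi i \<theta> = b then 0 else 1)"
      using vpos[of i] by simp
    also have "\<dots> \<le> v i * ?d"
      using vpos[of i] d by (intro mult_left_mono) auto
    finally show "v i - (if lo i \<theta> = a then v i else 0) - (if hi i \<theta> = b then v i else 0) \<le> v i * ?d" .
  qed
  also have "\<dots> \<le> NN v w \<theta> b - NN v w \<theta> a"
    unfolding NN_diff using vpos ab
    by (intro sum_mono2 mult_nonneg_nonneg clip_affine_mono) (auto simp: less_imp_le)
  finally have "(\<Sum>i\<in>active \<theta>. v i) - sum v ?L - sum v ?R \<le> NN v w \<theta> b - NN v w \<theta> a"
    by (simp add: sum_subtractf sum.If_cases Int_def)
  moreover have "sum v ?L \<le> overlap \<theta>"
  proof -
    have "eventually (\<lambda>x. (\<forall>i\<in>?L. x < hi i \<theta>) \<and> x \<in> {a<..<b}) (at_right a)"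
      using ab by (intro eventually_conj eventually_ball_finite ballI eventually_at_right_real)
        (auto simp: active_def intro: order_tendstoD(2)[OF tendsto_ident_at])
    then obtain x where "\<forall>i\<in>?L. x < hi i \<theta>" "x \<in> {a<..<b}"
      using eventually_happens' trivial_limit_at_right_real by blast
    then show ?thesis by (intro sum_le_overlap[of x]) auto
  qed
  moreover have "sum v ?R \<le> overlap \<theta>"
  proof -
    have "eventually (\<lambda>x. (\<forall>i\<in>?R. lo i \<theta> < x) \<and> x \<in> {a<..<b}) (at_left b)"
      using ab by (intro eventually_conj eventually_ball_finite ballI eventually_at_left_real)
        (auto simp: active_def intro: order_tendstoD(1)[OF tendsto_ident_at])
    then obtain x where "\<forall>i\<in>?R. lo i \<theta> < x" "x \<in> {a<..<b}"
      using eventually_happens' trivial_limit_at_left_real by blast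
    then show ?thesis by (intro sum_le_overlap[of x]) auto
  qed
  ultimately show ?thesis by simp
qed

text \<open>The error bounds at \<open>a\<close> and \<open>b\<close> limit the rise of the network
  to \<open>f b - f a + 2 * overlap \<theta>\<close>. The other two copies of
  \<open>overlap \<theta>\<close> come from the neurons cut off at the boundary in
  \<open>NN_total_rise\<close>.\<close>

lemma sum_active_le:
  assumes crit: "gradient \<theta> = 0"
  shows "(\<Sum>i\<in>active \<theta>. v i) \<le> f b - f a + 4 * overlap \<theta>"
proof (cases "active \<theta> = {}")
  case True
  then show ?thesis using overlap_nonneg[of \<theta>] f_le[of a b] ab by simp
next
  case False
  then obtain j where j: "j \<in> active \<theta>" by blast
  have "err \<theta> b \<le> overlap \<theta>" "- overlap \<theta> \<le> err \<theta> a"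
    using err_le_overlap[OF j _ _ crit, of b] err_ge_overlap[OF j _ _ crit, of a] lo_hi[of j \<theta>] ab
    by auto
  then show ?thesis using NN_total_rise[of \<theta>] by (simp add: err_def)
qed

text \<open>Since the weighted error has integral zero, integrate (err + A) (B - err) \<ge> 0.\<close>

lemma loss_le_of_bounds:
  assumes crit: "gradient \<theta> = 0"
    and "\<And>x. x \<in> {a..b} \<Longrightarrow> - A \<le> err \<theta> x" "\<And>x. x \<in> {a..b} \<Longrightarrow> err \<theta> x \<le> B"
  shows "loss a b f p v w \<theta> \<le> A * B * integral {a..b} p"
proof -
  have "loss a b f p v w \<theta> \<le> integral {a..b} (\<lambda>x. (B - A) * residual \<theta> x + A * B * p x)"
    unfolding loss_def
  proof (rule integral_le)
    show "(\<lambda>x. (NN v w \<theta> x - f x)\<^sup>2 * p x) integrable_on {a..b}"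
      by (intro integrable_continuous_real continuous_intros)
    show "(\<lambda>x. (B - A) * residual \<theta> x + A * B * p x) integrable_on {a..b}"
      by (intro integrable_continuous_real continuous_intros)
    fix x assume x: "x \<in> {a..b}"
    have "0 \<le> (err \<theta> x + A) * (B - err \<theta> x) * p x"
      using assms(2,3)[OF x] pnn[of x] by (intro mult_nonneg_nonneg) auto
    then show "(NN v w \<theta> x - f x)\<^sup>2 * p x \<le> (B - A) * residual \<theta> x + A * B * p x"
      unfolding residual_err err_def by (simp add: power2_eq_square algebra_simps)
  qed
  also have "\<dots> = (B - A) * integral {a..b} (residual \<theta>) + A * B * integral {a..b} p"
    by (subst integral_add) (auto intro!: integrable_continuous_real continuous_intros)
  finally show ?thesis using critical_integrals(1)[OF crit] by simp
qed

lemma overlap_max_bound: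
  "overlap \<theta> * max (f b - f a) (overlap \<theta>) * integral {a..b} p
   \<le> (2 * (overlap \<theta>)\<^sup>2 + (f b - f a) * overlap \<theta>) * integral {a..b} p"
proof (rule mult_right_mono)
  show "0 \<le> integral {a..b} p"
    by (intro integral_nonneg integrable_continuous_real continuous_on_subset[OF pcont] pnn) auto
  have "max (f b - f a) (overlap \<theta>) \<le> 2 * overlap \<theta> + (f b - f a)"
    using overlap_nonneg[of \<theta>] f_le[of a b] ab by auto
  from mult_left_mono[OF this overlap_nonneg[of \<theta>]]
  show "overlap \<theta> * max (f b - f a) (overlap \<theta>) \<le> 2 * (overlap \<theta>)\<^sup>2 + (f b - f a) * overlap \<theta>"
    by (simp add: power2_eq_square algebra_simps)
qed

text \<open>Right of all intervals the network keeps its value at \<open>b\<close>, so the sign of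
  the error at \<open>b\<close> bounds the error below. Left of all intervals the network is at most
  its value at some zero \<open>z\<close>, which equals \<open>f z\<close>.\<close>

lemma loss_bound_right:
  assumes crit: "gradient \<theta> = 0" and ne: "active \<theta> \<noteq> {}" and eb: "0 \<le> err \<theta> b"
  shows "loss a b f p v w \<theta>
    \<le> (2 * (overlap \<theta>)\<^sup>2 + (f b - f a) * overlap \<theta>) * integral {a..b} p"
proof (rule order_trans[OF loss_le_of_bounds[OF crit] overlap_max_bound])
  fix x assume x: "x \<in> {a..b}"
  show "- overlap \<theta> \<le> err \<theta> x"
  proof (cases "\<exists>j\<in>active \<theta>. x \<le> hi j \<theta>")
    case True
    then show ?thesis using err_ge_overlap crit x by auto
  next
    case False
    then have "NN v w \<theta> b = NN v w \<theta> x" using x by (intro NN_const) force+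
    then show ?thesis
      using f_le[of x b] x eb overlap_nonneg[of \<theta>] by (auto simp: err_def)
  qed
  show "err \<theta> x \<le> max (f b - f a) (overlap \<theta>)"
  proof (cases "\<exists>j\<in>active \<theta>. lo j \<theta> \<le> x")
    case True
    then show ?thesis using err_le_overlap crit x by force
  next
    case False
    obtain j where j: "j \<in> active \<theta>" using ne by blast
    obtain z where z: "lo j \<theta> < z" "z < hi j \<theta>" "err \<theta> z = 0" using active_zero[OF j crit] .
    have "NN v w \<theta> x \<le> NN v w \<theta> z" using False j z by (intro NN_mono) force
    then have "err \<theta> x \<le> f b - f a"
      using z f_le[of z b] f_le[of a x] x lo_hi[of j \<theta>] by (auto simp: err_def)
    then show ?thesis by simp
  qed
qed

text \<open>Mirror image, with the upper and lower bounds of the error exchanged.\<close>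

lemma loss_bound_left:
  assumes crit: "gradient \<theta> = 0" and ne: "active \<theta> \<noteq> {}" and ea: "err \<theta> a \<le> 0"
  shows "loss a b f p v w \<theta>
    \<le> (2 * (overlap \<theta>)\<^sup>2 + (f b - f a) * overlap \<theta>) * integral {a..b} p"
proof (rule order_trans[OF loss_le_of_bounds[OF crit] order_trans[OF _ overlap_max_bound]])
  fix x assume x: "x \<in> {a..b}"
  show "err \<theta> x \<le> overlap \<theta>"
  proof (cases "\<exists>j\<in>active \<theta>. lo j \<theta> \<le> x")
    case True
    then show ?thesis using err_le_overlap crit x by auto
  next
    case False
    then have "NN v w \<theta> x = NN v w \<theta> a" using x by (intro NN_const) force+
    then show ?thesis
      using f_le[of a x] x ea overlap_nonneg[of \<theta>] by (auto simp: err_def)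
  qed
  show "- max (f b - f a) (overlap \<theta>) \<le> err \<theta> x"
  proof (cases "\<exists>j\<in>active \<theta>. x \<le> hi j \<theta>")
    case True
    then show ?thesis using err_ge_overlap crit x by force
  next
    case False
    obtain j where j: "j \<in> active \<theta>" using ne by blast
    obtain z where z: "lo j \<theta> < z" "z < hi j \<theta>" "err \<theta> z = 0" using active_zero[OF j crit] .
    have "NN v w \<theta> z \<le> NN v w \<theta> x" using False j z by (intro NN_mono) force
    then have "- (f b - f a) \<le> err \<theta> x"
      using z f_le[of a z] f_le[of x b] x lo_hi[of j \<theta>] by (auto simp: err_def)
    then show ?thesis by simp
  qed
qed (simp add: mult.commute)

text \<open>Without active neurons the network is a constant that is at least \<open>f b\<close>, so
  the integrand lies below the residual, whose integral is zero. The smallness of V will contradict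
  this.\<close>

lemma no_active_right:
  assumes crit: "gradient \<theta> = 0" and ne: "active \<theta> = {}" and eb: "0 \<le> err \<theta> b"
  shows "integral {a..b} (\<lambda>x. (f b - f x) * p x) \<le> 0"
proof -
  have "integral {a..b} (\<lambda>x. (f b - f x) * p x) \<le> integral {a..b} (residual \<theta>)"
  proof (rule integral_le)
    fix x assume x: "x \<in> {a..b}"
    have "NN v w \<theta> b = NN v w \<theta> x" using x ne by (intro NN_const) auto
    then show "(f b - f x) * p x \<le> residual \<theta> x"
      unfolding residual_def using eb pnn[of x] by (intro mult_right_mono) (auto simp: err_def)
  qed (intro integrable_continuous_real continuous_intros)+
  then show ?thesis using critical_integrals(1)[OF crit] by simp
qed

lemma no_active_left:
  assumes crit: "gradient \<theta> = 0" and ne: "active \<theta> = {}" and ea: "err \<theta> a \<le> 0"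
  shows "integral {a..b} (\<lambda>x. (f x - f a) * p x) \<le> 0"
proof -
  have "integral {a..b} (residual \<theta>) \<le> integral {a..b} (\<lambda>x. - ((f x - f a) * p x))"
  proof (rule integral_le)
    fix x assume x: "x \<in> {a..b}"
    have "NN v w \<theta> x = NN v w \<theta> a" using x ne by (intro NN_const) auto
    then have "residual \<theta> x \<le> (f a - f x) * p x"
      unfolding residual_def using ea pnn[of x] by (intro mult_right_mono) (auto simp: err_def)
    then show "residual \<theta> x \<le> - ((f x - f a) * p x)" by (simp add: algebra_simps)
  qed (intro integrable_continuous_real continuous_intros)+
  then show ?thesis using critical_integrals(1)[OF crit] by simp
qed

end

subsection \<open>The gradient flow\<close>

text \<open>Increments of a convergent function over unit steps tend to 0, yet by the mean value
  theorem they are values of the derivative.\<close>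

lemma derivative_limit_zero:
  fixes y y' :: "real \<Rightarrow> real"
  assumes D: "\<And>t. t > 0 \<Longrightarrow> (y has_real_derivative y' t) (at t)"
    and L: "(y \<longlongrightarrow> L) at_top" and c: "(y' \<longlongrightarrow> c) at_top"
  shows "c = 0"
proof (rule ccontr)
  assume "c \<noteq> 0"
  \<comment> \<open>With tolerance \<open>\<bar>c\<bar> / 3\<close> a late unit increment has size
    below \<open>2 * \<bar>c\<bar> / 3\<close>, whereas the derivative has size above it.\<close>
  then have e: "\<bar>c\<bar> / 3 > 0" by simp
  have "eventually (\<lambda>t. \<bar>y t - L\<bar> < \<bar>c\<bar> / 3 \<and> \<bar>y' t - c\<bar> < \<bar>c\<bar> / 3) at_top"
    using tendstoD[OF L e] tendstoD[OF c e] by (simp add: eventually_conj_iff dist_real_def)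
  then obtain T where T: "\<And>t. t \<ge> T \<Longrightarrow> \<bar>y t - L\<bar> < \<bar>c\<bar> / 3 \<and> \<bar>y' t - c\<bar> < \<bar>c\<bar> / 3"
    unfolding eventually_at_top_linorder by blast
  define t where "t = max T 1"
  obtain z where z: "t < z" "z < t + 1" "y (t + 1) - y t = (t + 1 - t) * y' z"
    using MVT2[of t "t + 1" y y'] D by (force simp: t_def)
  have "T \<le> t" by (simp add: t_def)
  moreover have "y (t + 1) - y t = y' z" using z(3) by simp
  ultimately show False using T[of t] T[of "t + 1"] T[of z] z(1,2) by linarith
qed

lemma le_limit_of_deriv_nonneg:
  fixes y y' :: "real \<Rightarrow> real"
  assumes D: "\<And>t. t > 0 \<Longrightarrow> (y has_real_derivative y' t) (at t)"
    and L: "(y \<longlongrightarrow> L) at_top" and "T > 0" and nn: "\<And>t. t \<ge> T \<Longrightarrow> 0 \<le> y' t"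
  shows "y T \<le> L"
proof (rule tendsto_lowerbound[OF L])
  have "y T \<le> y t" if "t \<ge> T" for t
    using D nn \<open>T > 0\<close>
    by (intro DERIV_nonneg_imp_nondecreasing[OF that] exI[of _ "y' x" for x] conjI) auto
  then show "eventually (\<lambda>t. y T \<le> y t) at_top"
    unfolding eventually_at_top_linorder by blast
qed simp

text \<open>A Gronwall argument: up to the first time \<open>s\<close> with
  \<open>z s \<le> 0\<close> the function \<open>exp (C * t) * z t\<close> is non-decreasing. The
  positive part in the bound matches the length of a clamped interval.\<close>

lemma stays_positive:
  fixes z z' :: "real \<Rightarrow> real"
  assumes "0 \<le> T" "0 < z 0" and cont: "continuous_on {0..T} z"
    and D: "\<And>t. 0 < t \<Longrightarrow> t < T \<Longrightarrow> (z has_real_derivative z' t) (at t)"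
    and bound: "\<And>t. 0 < t \<Longrightarrow> t < T \<Longrightarrow> - C * max (z t) 0 \<le> z' t"
  shows "0 < z T"
proof (rule ccontr)
  assume "\<not> 0 < z T"
  let ?S = "{t \<in> {0..T}. z t \<le> 0}"
  have "closed ?S" by (intro continuous_on_closed_Collect_le cont continuous_intros)
  then have "compact ?S"
    by (auto simp: compact_eq_bounded_closed intro: bounded_subset[OF bounded_closed_interval[of 0 T]])
  moreover have "?S \<noteq> {}" using \<open>\<not> 0 < z T\<close> \<open>0 \<le> T\<close> by auto
  ultimately obtain s where s: "s \<in> ?S" "\<And>t. t \<in> ?S \<Longrightarrow> s \<le> t"
    using compact_attains_inf[of ?S] by blast
  have pos: "0 < z t" if "0 \<le> t" "t < s" for t
    using s(1) s(2)[of t] that by (cases "z t \<le> 0") auto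
  have "exp (C * 0) * z 0 \<le> exp (C * s) * z s"
  proof (rule DERIV_nonneg_imp_increasing_open[where f = "\<lambda>t. exp (C * t) * z t"])
    show "0 \<le> s" using s by simp
    show "continuous_on {0..s} (\<lambda>t. exp (C * t) * z t)"
      using s by (intro continuous_intros continuous_on_subset[OF cont]) auto
    fix t assume t: "0 < t" "t < s"
    have "((\<lambda>t. exp (C * t) * z t) has_real_derivative exp (C * t) * (C * z t + z' t)) (at t)"
      using D[of t] t s by (auto intro!: derivative_eq_intros simp: algebra_simps)
    moreover have "0 \<le> C * z t + z' t"
      using bound[of t] pos[of t] t s by simp
    ultimately show "\<exists>d. ((\<lambda>t. exp (C * t) * z t) has_real_derivative d) (at t) \<and> 0 \<le> d"
      by (intro exI[of _ "exp (C * t) * (C * z t + z' t)"]) simp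
  qed
  moreover have "exp (C * s) * z s \<le> 0" using s by (intro mult_nonneg_nonpos) auto
  ultimately show False using \<open>0 < z 0\<close> by simp
qed

locale network_gradient_flow = steep_network a b v w f p
  for a b :: real and v w :: "'h::finite \<Rightarrow> real" and f p :: "real \<Rightarrow> real" +
  fixes Th :: "real \<Rightarrow> real ^ ('h option)" and vth :: "real ^ ('h option)"
  assumes Thcont: "continuous_on {0..} Th"
    and flow: "\<And>t. t \<ge> 0 \<Longrightarrow> Th t = Th 0 - integral {0..t} (\<lambda>s. gradient (Th s))"
    and Thlim: "(Th \<longlongrightarrow> vth) at_top"
begin

lemma Th_deriv:
  assumes "t > 0"
  shows "((\<lambda>s. Th s $ j) has_real_derivative - gradient (Th t) $ j) (at t)"
proof -
  have "continuous_on {0..t + 1} (\<lambda>s. gradient (Th s))"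
    by (rule continuous_on_compose2[OF cont_gradient continuous_on_subset[OF Thcont]]) auto
  then have "((\<lambda>u. integral {0..u} (\<lambda>s. gradient (Th s))) has_vector_derivative gradient (Th t))
      (at t within {0..t + 1})"
    using assms by (intro integral_has_vector_derivative) auto
  then have "((\<lambda>u. integral {0..u} (\<lambda>s. gradient (Th s))) has_vector_derivative gradient (Th t)) (at t)"
    using assms at_within_interior[of t "{0..t + 1}"] by simp
  from bounded_linear.has_vector_derivative[OF bounded_linear_vec_nth
      has_vector_derivative_diff[OF has_vector_derivative_const[of "Th 0"] this]]
  have "((\<lambda>u. (Th 0 - integral {0..u} (\<lambda>s. gradient (Th s))) $ j)
      has_real_derivative - gradient (Th t) $ j) (at t)"
    by (simp only: has_real_derivative_iff_has_vector_derivative diff_0 vector_uminus_component)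
  then show ?thesis
    by (rule has_field_derivative_transform_within[of _ _ _ _ t])
      (use assms in \<open>auto simp: dist_real_def flow[symmetric]\<close>)
qed

text \<open>By continuity of the gradient the velocity converges too, and its limit must be zero
  along a convergent trajectory.\<close>

lemma limit_critical: "gradient vth = 0"
proof -
  have "gradient vth $ j = 0" for j
  proof -
    have "((\<lambda>t. gradient (Th t)) \<longlongrightarrow> gradient vth) at_top"
      by (rule continuous_on_tendsto_compose[OF cont_gradient Thlim]) auto
    then have "((\<lambda>t. - gradient (Th t) $ j) \<longlongrightarrow> - gradient vth $ j) at_top"
      by (intro tendsto_intros)
    from derivative_limit_zero[OF Th_deriv tendsto_vec_nth[OF Thlim] this]
    show ?thesis by simp
  qed
  then show ?thesis by (simp add: vec_eq_iff)
qed

section \<open>Active neurons stay active in finite time\<close>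

lemma residual_bounded:
  obtains K where "K \<ge> 0"
    "\<And>t x. t \<in> {0..T} \<Longrightarrow> x \<in> {a..b} \<Longrightarrow> \<bar>residual (Th t) x\<bar> \<le> K"
proof -
  have "continuous_on ({0..T} \<times> {a..b}) (\<lambda>q. residual (Th (fst q)) (snd q))"
    by (intro continuous_intros continuous_on_compose2[OF Thcont]) auto
  then have "bounded ((\<lambda>q. residual (Th (fst q)) (snd q)) ` ({0..T} \<times> {a..b}))"
    by (intro compact_imp_bounded compact_continuous_image compact_Times) auto
  then obtain K where K: "\<forall>q\<in>{0..T} \<times> {a..b}. \<bar>residual (Th (fst q)) (snd q)\<bar> \<le> K"
    by (auto simp: bounded_iff)
  show ?thesis
  proof (rule that[of "max K 0"])
    fix t x assume "t \<in> {0..T}" "x \<in> {a..b}"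
    then have "\<bar>residual (Th t) x\<bar> \<le> K" using bspec[OF K, of "(t, x)"] by simp
    then show "\<bar>residual (Th t) x\<bar> \<le> max K 0" by simp
  qed simp
qed

text \<open>The quotient by \<open>w i\<close> is the speed of \<open>psi\<close>. The residual is
  bounded on the compact set of times up to \<open>T\<close> and points of the domain, so its
  integral is at most a multiple of the interval length.\<close>

lemma gradient_bounded:
  obtains C where "\<And>t. t \<in> {0..T} \<Longrightarrow>
    \<bar>gradient (Th t) $ Some i\<bar> / w i \<le> C * (hi i (Th t) - lo i (Th t))" "C \<ge> 0"
proof -
  obtain K where K: "K \<ge> 0"
    "\<And>t x. t \<in> {0..T} \<Longrightarrow> x \<in> {a..b} \<Longrightarrow> \<bar>residual (Th t) x\<bar> \<le> K"
    using residual_bounded by blast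
  show ?thesis
  proof (rule that[of "2 * v i * K / w i"])
    fix t assume t: "t \<in> {0..T}"
    have "norm (integral {lo i (Th t)..hi i (Th t)} (residual (Th t)))
        \<le> K * (hi i (Th t) - lo i (Th t))"
      using K(2)[OF t] lo_hi[of i "Th t"] by (intro integral_bound cont_residual1) auto
    from mult_left_mono[OF this, of "2 * v i / w i"]
    show "\<bar>gradient (Th t) $ Some i\<bar> / w i \<le> 2 * v i * K / w i * (hi i (Th t) - lo i (Th t))"
      using vpos[of i] wpos[of i] by (simp add: gradient_def abs_mult mult_ac)
  qed (use K vpos[of i] wpos[of i] in simp)
qed

lemma cont_psi: "continuous_on {0..T} (\<lambda>t. psi w i (Th t))"
  unfolding psi_def by (intro continuous_intros continuous_on_subset[OF Thcont]) auto

lemma psi_deriv: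
  "t > 0 \<Longrightarrow> ((\<lambda>t. psi w i (Th t)) has_real_derivative gradient (Th t) $ Some i / w i) (at t)"
  unfolding psi_def using wpos[of i] by (auto intro!: derivative_eq_intros Th_deriv)

text \<open>The speed of a neuron is controlled by the length of its interval inside [a, b], so by
  Gronwall this length cannot vanish in finite time.\<close>

lemma psi_stays_below:
  assumes "psi w i (Th 0) < b" "0 \<le> T"
  shows "psi w i (Th T) < b"
proof -
  obtain C where C: "\<And>t. t \<in> {0..T} \<Longrightarrow>
    \<bar>gradient (Th t) $ Some i\<bar> / w i \<le> C * (hi i (Th t) - lo i (Th t))" "C \<ge> 0"
    using gradient_bounded by blast
  have "0 < b - psi w i (Th T)"
  proof (rule stays_positive[where C = C and z = "\<lambda>t. b - psi w i (Th t)"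
        and z' = "\<lambda>t. - (gradient (Th t) $ Some i / w i)"])
    show "continuous_on {0..T} (\<lambda>t. b - psi w i (Th t))"
      by (intro continuous_intros cont_psi)
    fix t assume t: "0 < t" "t < T"
    show "((\<lambda>t. b - psi w i (Th t)) has_real_derivative - (gradient (Th t) $ Some i / w i)) (at t)"
      using psi_deriv[OF t(1)] by (auto intro!: derivative_eq_intros)
    have "hi i (Th t) - lo i (Th t) \<le> max (b - psi w i (Th t)) 0"
      using lo_hi[of i "Th t"] by (auto simp: lo_def)
    from mult_left_mono[OF this C(2)]
    have "\<bar>gradient (Th t) $ Some i\<bar> / w i \<le> C * max (b - psi w i (Th t)) 0"
      using C(1)[of t] t by simp
    moreover have "gradient (Th t) $ Some i / w i \<le> \<bar>gradient (Th t) $ Some i\<bar> / w i"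
      using wpos[of i] by (intro divide_right_mono) auto
    ultimately show "- C * max (b - psi w i (Th t)) 0 \<le> - (gradient (Th t) $ Some i / w i)"
      by simp
  qed (use assms in auto)
  then show ?thesis by simp
qed

text \<open>The same estimate for the distance from \<open>a\<close> to the right end
  \<open>psi + 1 / w i\<close>.\<close>

lemma psi_stays_above:
  assumes "a - 1 / w i < psi w i (Th 0)" "0 \<le> T"
  shows "a - 1 / w i < psi w i (Th T)"
proof -
  obtain C where C: "\<And>t. t \<in> {0..T} \<Longrightarrow>
    \<bar>gradient (Th t) $ Some i\<bar> / w i \<le> C * (hi i (Th t) - lo i (Th t))" "C \<ge> 0"
    using gradient_bounded by blast
  have "0 < psi w i (Th T) + 1 / w i - a"
  proof (rule stays_positive[where C = C and z = "\<lambda>t. psi w i (Th t) + 1 / w i - a"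
        and z' = "\<lambda>t. gradient (Th t) $ Some i / w i"])
    show "continuous_on {0..T} (\<lambda>t. psi w i (Th t) + 1 / w i - a)"
      by (intro continuous_intros cont_psi)
    fix t assume t: "0 < t" "t < T"
    show "((\<lambda>t. psi w i (Th t) + 1 / w i - a) has_real_derivative gradient (Th t) $ Some i / w i) (at t)"
      using psi_deriv[OF t(1)] by (auto intro!: derivative_eq_intros)
    have "hi i (Th t) - lo i (Th t) \<le> max (psi w i (Th t) + 1 / w i - a) 0"
      using lo_hi[of i "Th t"] by (auto simp: hi_def)
    from mult_left_mono[OF this C(2)]
    have "\<bar>gradient (Th t) $ Some i\<bar> / w i \<le> C * max (psi w i (Th t) + 1 / w i - a) 0"
      using C(1)[of t] t by simp
    moreover have "- \<bar>gradient (Th t) $ Some i\<bar> / w i \<le> gradient (Th t) $ Some i / w i"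
      using wpos[of i] by (intro divide_right_mono) auto
    ultimately show "- C * max (psi w i (Th t) + 1 / w i - a) 0 \<le> gradient (Th t) $ Some i / w i"
      by simp
  qed (use assms in auto)
  then show ?thesis by simp
qed

section \<open>Neurons that become inactive in the limit\<close>

lemma psi_limit: "((\<lambda>t. psi w i (Th t)) \<longlongrightarrow> psi w i vth) at_top"
  unfolding psi_def by (intro tendsto_intros Thlim)

text \<open>Joint continuity of the error in parameters and position transfers a strict sign at the
  limit to a neighbourhood of \<open>x\<close> at all late times.\<close>

lemma eventually_err_near:
  assumes "open U" "err vth x \<in> U"
  obtains e where "e > 0"
    "eventually (\<lambda>t. \<forall>y. \<bar>y - x\<bar> < e \<longrightarrow> err (Th t) y \<in> U) at_top"
proof -
  have "continuous_on UNIV (\<lambda>q. err (fst q) (snd q))"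
    unfolding err_def by (intro continuous_intros)
  from open_vimage[OF \<open>open U\<close> this]
  have "open ((\<lambda>q. err (fst q) (snd q)) -` U)" .
  then obtain A B where AB: "open A" "open B" "(vth, x) \<in> A \<times> B"
    "A \<times> B \<subseteq> (\<lambda>q. err (fst q) (snd q)) -` U"
    using assms(2) by (auto elim!: open_prod_elim)
  obtain e where e: "e > 0" "ball x e \<subseteq> B" using AB openE[of B x] by auto
  have "eventually (\<lambda>t. Th t \<in> A) at_top" using topological_tendstoD[OF Thlim] AB by auto
  then have "eventually (\<lambda>t. \<forall>y. \<bar>y - x\<bar> < e \<longrightarrow> err (Th t) y \<in> U) at_top"
  proof eventually_elim
    case (elim t)
    have "err (Th t) y \<in> U" if "\<bar>y - x\<bar> < e" for y
      using elim subsetD[OF AB(4), of "(Th t, y)"] subsetD[OF e(2), of y] that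
      by (auto simp: dist_real_def abs_minus_commute)
    then show ?case by blast
  qed
  with e(1) show ?thesis by (rule that)
qed

text \<open>If the error at b were negative, a neuron approaching b from the left would eventually
  move to the left only.\<close>

lemma err_right_nonneg:
  assumes below: "psi w i (Th 0) < b" and lim: "psi w i vth = b"
  shows "0 \<le> err vth b"
proof (rule ccontr)
  assume "\<not> 0 \<le> err vth b"
  then obtain e where e: "e > 0"
    "eventually (\<lambda>t. \<forall>y. \<bar>y - b\<bar> < e \<longrightarrow> err (Th t) y \<in> {..<0}) at_top"
    using eventually_err_near[of "{..<0}" b] by auto
  have "eventually (\<lambda>t. b - e < psi w i (Th t)) at_top"
    using order_tendstoD(1)[OF psi_limit, of "b - e" i] lim e by simp
  with e(2) have "eventually (\<lambda>t. 0 \<le> - (gradient (Th t) $ Some i / w i)) at_top"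
  proof eventually_elim
    case (elim t)
    have "integral {lo i (Th t)..hi i (Th t)} (residual (Th t)) \<le> integral {lo i (Th t)..hi i (Th t)} (\<lambda>x. 0)"
    proof (rule integral_le)
      fix x assume x: "x \<in> {lo i (Th t)..hi i (Th t)}"
      then have "\<bar>x - b\<bar> < e" using elim lo_hi[of i "Th t"] e by (auto simp: lo_def)
      then show "residual (Th t) x \<le> 0"
        using elim(1) pnn[of x] by (auto simp: residual_err less_imp_le intro!: mult_nonpos_nonneg)
    qed (auto intro: integrable_continuous_real cont_residual1)
    then show ?case
      using vpos[of i] wpos[of i] by (simp add: gradient_def divide_le_0_iff mult_le_0_iff)
  qed
  then obtain T where T: "\<And>t. t \<ge> T \<Longrightarrow> 0 \<le> - (gradient (Th t) $ Some i / w i)"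
    unfolding eventually_at_top_linorder by blast
  \<comment> \<open>From time \<open>T\<close> on, \<open>psi\<close> is non-increasing, so at a
    finite time it is at least its limit \<open>b\<close>, which \<open>psi_stays_below\<close>
    forbids.\<close>
  have "- psi w i (Th (max T 1)) \<le> - psi w i vth"
    using psi_deriv T by (intro le_limit_of_deriv_nonneg[where y = "\<lambda>t. - psi w i (Th t)"])
      (auto intro!: derivative_eq_intros tendsto_minus psi_limit)
  moreover have "psi w i (Th (max T 1)) < b" by (rule psi_stays_below[OF below]) simp
  ultimately show False using lim by simp
qed

text \<open>Mirror image: a positive error near \<open>a\<close> eventually moves the neuron only to
  the right, so it cannot approach the threshold from above.\<close>

lemma err_left_nonpos:
  assumes above: "a - 1 / w i < psi w i (Th 0)" and lim: "psi w i vth = a - 1 / w i"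
  shows "err vth a \<le> 0"
proof (rule ccontr)
  assume "\<not> err vth a \<le> 0"
  then obtain e where e: "e > 0"
    "eventually (\<lambda>t. \<forall>y. \<bar>y - a\<bar> < e \<longrightarrow> err (Th t) y \<in> {0<..}) at_top"
    using eventually_err_near[of "{0<..}" a] by auto
  have "eventually (\<lambda>t. psi w i (Th t) < a - 1 / w i + e) at_top"
    using order_tendstoD(2)[OF psi_limit, of i "a - 1 / w i + e"] lim e by simp
  with e(2) have "eventually (\<lambda>t. 0 \<le> gradient (Th t) $ Some i / w i) at_top"
  proof eventually_elim
    case (elim t)
    have "integral {lo i (Th t)..hi i (Th t)} (\<lambda>x. 0) \<le> integral {lo i (Th t)..hi i (Th t)} (residual (Th t))"
    proof (rule integral_le)
      fix x assume x: "x \<in> {lo i (Th t)..hi i (Th t)}"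
      then have "\<bar>x - a\<bar> < e" using elim lo_hi[of i "Th t"] e by (auto simp: hi_def)
      then show "0 \<le> residual (Th t) x"
        using elim(1) pnn[of x] by (auto simp: residual_err less_imp_le intro!: mult_nonneg_nonneg)
    qed (auto intro: integrable_continuous_real cont_residual1)
    then show ?case
      using vpos[of i] wpos[of i] by (simp add: gradient_def)
  qed
  then obtain T where T: "\<And>t. t \<ge> T \<Longrightarrow> 0 \<le> gradient (Th t) $ Some i / w i"
    unfolding eventually_at_top_linorder by blast
  have "psi w i (Th (max T 1)) \<le> psi w i vth"
    using psi_deriv T by (intro le_limit_of_deriv_nonneg[where y = "\<lambda>t. psi w i (Th t)"])
      (auto intro!: psi_limit)
  moreover have "a - 1 / w i < psi w i (Th (max T 1))" by (rule psi_stays_above[OF above]) simp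
  ultimately show False using lim by simp
qed

text \<open>The initially active mass exceeds what a critical point allows by
  \<open>sum_active_le\<close>, so some neuron is lost in the limit. As it stays active in finite
  time, its limit position is exactly one of the two thresholds.\<close>

lemma limit_err_sign:
  assumes init: "(\<Sum>i\<in>UNIV. v i * indicator {a - 1 / w i <..< b} (psi w i (Th 0)))
      > f b - f a + 4 * overlap vth"
  shows "0 \<le> err vth b \<or> err vth a \<le> 0"
proof -
  let ?I = "{i. psi w i (Th 0) \<in> {a - 1 / w i <..< b}}"
  have "(\<Sum>i\<in>UNIV. v i * indicator {a - 1 / w i <..< b} (psi w i (Th 0)))
      = (\<Sum>i\<in>UNIV. if i \<in> ?I then v i else 0)"
    by (intro sum.cong) (auto simp: indicator_def)
  also have "\<dots> = sum v ?I" by (simp add: sum.If_cases)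
  finally have "sum v (active vth) < sum v ?I"
    using init sum_active_le[OF limit_critical] by simp
  moreover have "sum v ?I \<le> sum v (active vth)" if "?I \<subseteq> active vth"
    using that vpos by (intro sum_mono2) (auto simp: less_imp_le)
  ultimately have "\<not> ?I \<subseteq> active vth" by linarith
  then obtain i where i: "psi w i (Th 0) < b" "a - 1 / w i < psi w i (Th 0)" "i \<notin> active vth"
    by auto
  have "psi w i vth \<le> b"
    by (rule tendsto_upperbound[OF psi_limit])
      (auto simp: eventually_at_top_linorder intro!: exI[of _ 0] less_imp_le psi_stays_below i)
  moreover have "a - 1 / w i \<le> psi w i vth"
    by (rule tendsto_lowerbound[OF psi_limit])
      (auto simp: eventually_at_top_linorder intro!: exI[of _ 0] less_imp_le psi_stays_above i)
  moreover have "psi w i vth < psi w i vth + 1 / w i" using wpos[of i] by simp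
  ultimately have "psi w i vth = b \<or> psi w i vth = a - 1 / w i"
    using i(3) ab unfolding active_def lo_def hi_def by (auto simp: max_def min_def split: if_splits)
  then show ?thesis using err_right_nonneg i err_left_nonpos by blast
qed

lemma limit_loss_le:
  assumes init: "(\<Sum>i\<in>UNIV. v i * indicator {a - 1 / w i <..< b} (psi w i (Th 0)))
      > f b - f a + 4 * overlap vth"
    and small: "overlap vth < (1 / integral {a..b} p) *
      min (integral {a..b} (\<lambda>x. (f b - f x) * p x)) (integral {a..b} (\<lambda>x. (f x - f a) * p x))"
  shows "loss a b f p v w vth
    \<le> (2 * (overlap vth)\<^sup>2 + (f b - f a) * overlap vth) * integral {a..b} p"
proof -
  let ?m = "min (integral {a..b} (\<lambda>x. (f b - f x) * p x)) (integral {a..b} (\<lambda>x. (f x - f a) * p x))"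
  have "0 \<le> integral {a..b} p"
    by (intro integral_nonneg integrable_continuous_real continuous_on_subset[OF pcont] pnn) auto
  \<comment> \<open>A positive product also excludes zero mass, since \<open>1 / 0 = 0\<close>;
    hence the minimum itself is positive.\<close>
  moreover have "0 < (1 / integral {a..b} p) * ?m"
    using small overlap_nonneg[of vth] by linarith
  ultimately have m: "0 < ?m"
    by (auto simp: zero_less_divide_iff)
  have "active vth \<noteq> {}"
    using limit_err_sign[OF init] no_active_right[OF limit_critical] no_active_left[OF limit_critical] m
    by force
  then show ?thesis
    using limit_err_sign[OF init] loss_bound_right[OF limit_critical] loss_bound_left[OF limit_critical]
    by blast
qed

end

lemma tendsto_of_Limsup_norm_zero:
  fixes X :: "real \<Rightarrow> 'a::real_normed_vector"
  assumes "Limsup at_top (\<lambda>t. ereal (norm (X t - l))) = 0"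
  shows "(X \<longlongrightarrow> l) at_top"
proof -
  have "0 \<le> Liminf at_top (\<lambda>t. ereal (norm (X t - l)))"
    by (rule Liminf_bounded) simp
  moreover have "Liminf at_top (\<lambda>t. ereal (norm (X t - l))) \<le> 0"
    using Liminf_le_Limsup[of "at_top :: real filter" "\<lambda>t. ereal (norm (X t - l))"] assms by simp
  ultimately have "((\<lambda>t. ereal (norm (X t - l))) \<longlongrightarrow> ereal 0) at_top"
    using assms by (subst tendsto_iff_Liminf_eq_Limsup) auto
  then show ?thesis
    by (simp add: tendsto_norm_zero_iff LIM_zero_iff)
qed

theorem theorem2p27:
  fixes a b :: real and v w :: "'h::finite \<Rightarrow> real" and f p :: "real \<Rightarrow> real"
    and Th :: "real \<Rightarrow> real ^ ('h option)" and vth :: "real ^ ('h option)"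
  assumes ab: "a < b"
    and vpos: "\<And>i. v i > 0" and wpos: "\<And>i. w i > 0"
    and fcont: "continuous_on UNIV f" and pcont: "continuous_on UNIV p"
    and pnn: "\<And>x. p x \<ge> 0"
    and psupp: "{x. p x > 0} = {a<..<b}"
    and fmono: "mono f"
    and flip: "Lip a b f < ereal (Min ((\<lambda>i. v i * w i) ` UNIV))"
    and Thcont: "continuous_on {0..} Th"
    and flow: "\<And>t. t \<ge> 0 \<Longrightarrow>
       Th t = Th 0 - integral {0..t} (\<lambda>s. grad (loss a b f p v w) (Th s))"
    and conv: "Limsup at_top (\<lambda>t. ereal (norm (Th t - vth))) = 0"
    and Vsmall: "(SUP x\<in>{a<..<b}. (\<Sum>i\<in>{i. x \<in> Iset a b w i vth}. v i))
       < (1 / integral {a..b} p) *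
         min (integral {a..b} (\<lambda>x. (f b - f x) * p x)) (integral {a..b} (\<lambda>x. (f x - f a) * p x))"
    and init: "(\<Sum>i\<in>UNIV. v i * indicator {a - 1 / w i <..< b} (psi w i (Th 0)))
       > f b - f a + 4 * (SUP x\<in>{a<..<b}. (\<Sum>i\<in>{i. x \<in> Iset a b w i vth}. v i))"
  shows "loss a b f p v w vth \<le>
     (2 * (SUP x\<in>{a<..<b}. (\<Sum>i\<in>{i. x \<in> Iset a b w i vth}. v i))\<^sup>2
      + (f b - f a) * (SUP x\<in>{a<..<b}. (\<Sum>i\<in>{i. x \<in> Iset a b w i vth}. v i)))
     * integral {a..b} p"
proof -
  interpret clipped_network a b v w f p
    using ab vpos wpos fcont pcont by unfold_locales
  interpret steep_network a b v w f p
    using pnn psupp fmono flip by unfold_locales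
  interpret network_gradient_flow a b v w f p Th vth
    by unfold_locales (fact Thcont flow[unfolded grad_eq] tendsto_of_Limsup_norm_zero[OF conv])+
  show ?thesis
    using limit_loss_le[unfolded overlap_def, OF init Vsmall] .
qed

end
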